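(* For any (nonzero) commutative Artinian ring $R$ with identity, $\omega(\Gamma_{reg}(R))=2|\mathrm{Max}(R)|-f(R)-1$.
   Context: $\mathrm{Max}(R)$ is the set of maximal ideals of $R$. Every Artinian ring $R$ is isomorphic to a finite direct product of Artinian local rings, and $f(R)$ denotes the number of fields appearing among the factors of this decomposition. An ideal is non-trivial if it is neither $(0)$ nor the whole ring. For a commutative ring $R$ with identity and an ideal $J$ of $R$, an element $x\in R$ is called $J$-regular if it is not a zero-divisor on $J$, i.e. $xy\neq 0$ for every $0\neq y\in J$. The regular graph of ideals $\Gamma_{reg}(R)$ is the simple undirected graph whose vertices are the non-trivial ideals of $R$, two distinct vertices $I,J$ being adjacent if and only if $I$ contains a $J$-regular element or $J$ contains an $I$-regular element. $\omega(G)$ denotes the clique number of a graph $G$. For a field $F$ the graph $\Gamma_{reg}(F)$ has no vertices and $\omega(\Gamma_{reg}(F))=0$. *)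

theory Defs
  imports "HOL-Algebra.Algebra" "HOL-Library.Extended_Nat"
begin

text \<open>A simple undirected graph is a set of vertices together with a set of two-element
  sets of vertices.\<close>

type_synonym 'v graph = "'v set \<times> 'v set set"

definition is_clique :: "'v graph \<Rightarrow> 'v set \<Rightarrow> bool" where
  "is_clique G C \<longleftrightarrow> C \<subseteq> fst G \<and> (\<forall>u\<in>C. \<forall>v\<in>C. u \<noteq> v \<longrightarrow> {u, v} \<in> snd G)"

text \<open>The supremum is \<open>\<infinity>\<close> if there are arbitrarily large finite cliques, in particular if there
  is an infinite clique; the empty clique makes it \<open>0\<close> for the graph without vertices.\<close>

definition clique_number :: "'v graph \<Rightarrow> enat" where
  "clique_number G = Sup ((\<lambda>C. enat (card C)) ` {C. finite C \<and> is_clique G C})"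

locale artinian_cring = cring +
  assumes descending_chain:
    "\<lbrakk>\<And>n :: nat. ideal (I n) R; \<And>n. I (Suc n) \<subseteq> I n\<rbrakk> \<Longrightarrow> \<exists>N. \<forall>n\<ge>N. I n = I N"

definition max_ideals :: "('a, 'm) ring_scheme \<Rightarrow> 'a set set" where
  "max_ideals R = {M. maximalideal M R}"

definition artinian_local_ring :: "('a, 'm) ring_scheme \<Rightarrow> bool" where
  "artinian_local_ring R \<longleftrightarrow> artinian_cring R \<and> (\<exists>!M. maximalideal M R)"

definition local_decomposition :: "('a, 'm) ring_scheme \<Rightarrow> ('b, 'n) ring_scheme list \<Rightarrow> bool" where
  "local_decomposition R Rs \<longleftrightarrow>
     (\<forall>S\<in>set Rs. artinian_local_ring S) \<and> R \<simeq> RDirProd_list Rs"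

text \<open>The factors may be taken on the carrier type of the ring itself without loss of generality:
  each of them embeds (as a set) into the product. The number of fields does not depend on the
  decomposition, which is unique up to isomorphism and order of the factors.\<close>

definition num_field_factors :: "('a, 'm) ring_scheme \<Rightarrow> nat" where
  "num_field_factors R =
     (THE k. \<exists>Rs :: 'a ring list. local_decomposition R Rs \<and> k = length (filter field Rs))"

definition regular_element :: "('a, 'm) ring_scheme \<Rightarrow> 'a set \<Rightarrow> 'a \<Rightarrow> bool" where
  "regular_element R J x \<longleftrightarrow>
     x \<in> carrier R \<and> (\<forall>y\<in>J. y \<noteq> \<zero>\<^bsub>R\<^esub> \<longrightarrow> x \<otimes>\<^bsub>R\<^esub> y \<noteq> \<zero>\<^bsub>R\<^esub>)"

definition nontrivial_ideals :: "('a, 'm) ring_scheme \<Rightarrow> 'a set set" where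
  "nontrivial_ideals R = {I. ideal I R \<and> I \<noteq> {\<zero>\<^bsub>R\<^esub>} \<and> I \<noteq> carrier R}"

definition regular_graph :: "('a, 'm) ring_scheme \<Rightarrow> 'a set graph" where
  "regular_graph R =
     (nontrivial_ideals R,
      {{I, J} | I J. I \<in> nontrivial_ideals R \<and> J \<in> nontrivial_ideals R \<and> I \<noteq> J \<and>
         ((\<exists>x\<in>I. regular_element R J x) \<or> (\<exists>x\<in>J. regular_element R I x))})"

end

theory Submission
  imports Defs
begin

text \<open>
  Write \<open>R\<close> as a product of \<open>n\<close> Artinian local rings, \<open>f\<close> of which are fields. For an ideal \<open>I\<close>
  let \<open>full I\<close> be the set of factors that \<open>I\<close> contains entirely and \<open>supp I\<close> the set of factors in
  which \<open>I\<close> is nonzero. In an Artinian local ring a non-unit is nilpotent, hence a zero-divisor on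
  every nonzero ideal; therefore \<open>I\<close> contains a \<open>J\<close>-regular element if and only if
  \<open>supp J \<subseteq> full I\<close> (lemma \<open>regular_iff_supp_subset_full\<close>).

  Give each ideal a level, the number of its full factors plus the number of its supporting factors
  that are not fields. It ranges from \<open>0\<close>, attained only by the zero ideal, to \<open>2 n - f\<close>, attained
  only by \<open>R\<close>. When \<open>supp J \<subseteq> full I\<close> and \<open>I \<noteq> J\<close>, the level of \<open>I\<close> is strictly larger than that of
  \<open>J\<close> (lemma \<open>level_strict_mono\<close>). So a clique has at most one ideal on each of the \<open>2 n - f - 1\<close>
  levels in between. Filling up the factors one after the other, and passing through the
  maximal ideal of each factor that is not a field, gives a clique with one ideal on each
  of these levels (lemma \<open>ex_clique\<close>). Moreover \<open>R\<close> has exactly \<open>n\<close> maximal ideals.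

  The decomposition is handled inside \<open>R\<close>, as a complete system of orthogonal idempotents
  \<open>e\<^sub>i\<close> such that the rings \<open>e\<^sub>i R\<close> are local. Such a system exists in every Artinian ring: by the
  descending chain condition \<open>\<one>\<close> is a sum of orthogonal primitive idempotents, and a primitive
  idempotent \<open>e\<close> is local because every element of \<open>e R\<close> is a unit or nilpotent there
  (lemmas \<open>idempotent_decomposition\<close> and \<open>primitive_imp_local_idempotent\<close>). Each isomorphism of \<open>R\<close>
  with a product of Artinian local rings yields such a system, and conversely. The formula for
  the clique number applies to all of them, which is also why the number of field factors does not
  depend on the decomposition.
\<close>

section \<open>Local idempotents\<close>

text \<open>When \<open>e\<close> is idempotent, these are the elements whose component \<open>e x\<close> is not a unit of the
  ring \<open>e R\<close>; for \<open>e = \<one>\<close> they are the non-units of \<open>R\<close>.\<close>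

definition nonunits_at :: "('a, 'm) ring_scheme \<Rightarrow> 'a \<Rightarrow> 'a set" where
  "nonunits_at R e = {x \<in> carrier R. \<forall>r\<in>carrier R. r \<otimes>\<^bsub>R\<^esub> x \<noteq> e}"

text \<open>The idempotents \<open>e\<close> for which \<open>e R\<close> is local with the following weak nilpotency of its
  maximal ideal: a non-unit annihilates a nonzero multiple of every nonzero element of \<open>e R\<close>. Unlike
  nilpotency, this condition is free of powers and is visibly invariant under the
  isomorphism of \<open>e R\<close> with another ring. The ideal condition forces \<open>e \<noteq> \<zero>\<close>, because \<open>\<zero>\<close>
  must not divide \<open>e\<close>.\<close>

definition local_idempotent :: "('a, 'm) ring_scheme \<Rightarrow> 'a \<Rightarrow> bool" where
  "local_idempotent R e \<longleftrightarrow> e \<in> carrier R \<and> e \<otimes>\<^bsub>R\<^esub> e = e \<and> ideal (nonunits_at R e) R \<and>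
     (\<forall>x\<in>nonunits_at R e. \<forall>y\<in>carrier R. e \<otimes>\<^bsub>R\<^esub> y \<noteq> \<zero>\<^bsub>R\<^esub> \<longrightarrow>
        (\<exists>s\<in>carrier R. s \<otimes>\<^bsub>R\<^esub> (e \<otimes>\<^bsub>R\<^esub> y) \<noteq> \<zero>\<^bsub>R\<^esub> \<and> x \<otimes>\<^bsub>R\<^esub> (s \<otimes>\<^bsub>R\<^esub> (e \<otimes>\<^bsub>R\<^esub> y)) = \<zero>\<^bsub>R\<^esub>))"

lemma nonunits_at_carrier: "x \<in> nonunits_at R f \<Longrightarrow> x \<in> carrier R"
  by (simp add: nonunits_at_def)

lemma (in cring) one_minus_dvd_one_minus_pow:
  assumes "u \<in> carrier R"
  shows "\<exists>s\<in>carrier R. s \<otimes> (\<one> \<ominus> u) = \<one> \<ominus> u [^] (k::nat)"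
proof (induction k)
  case 0
  then show ?case using assms by (intro bexI[of _ \<zero>]) (auto simp: r_neg minus_eq)
next
  case (Suc k)
  then obtain s where s: "s \<in> carrier R" "s \<otimes> (\<one> \<ominus> u) = \<one> \<ominus> u [^] k" by blast
  let ?p = "u [^] k"
  have p: "?p \<in> carrier R" using assms by simp
  have "(s \<oplus> ?p) \<otimes> (\<one> \<ominus> u) = s \<otimes> (\<one> \<ominus> u) \<oplus> ?p \<otimes> (\<one> \<ominus> u)"
    using s p assms by (simp add: l_distr)
  also have "\<dots> = (\<one> \<ominus> ?p) \<oplus> ?p \<otimes> (\<one> \<ominus> u)" using s by simp
  also have "\<dots> = \<one> \<ominus> ?p \<otimes> u" using p assms by algebra
  finally show ?case using s p by (intro bexI[of _ "s \<oplus> ?p"]) auto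
qed

text \<open>The argument that a ring in which every element is a unit or nilpotent is local, carried
  out in \<open>e R\<close>. If \<open>x\<close>, \<open>y\<close> are non-units and \<open>r (x + y) = e\<close>, then \<open>u = r x\<close> is nilpotent, so
  \<open>\<one> - u\<close> is a unit by the geometric series, and therefore so is \<open>r y = e - u\<close>, a contradiction.
  A nonzero multiple of \<open>e y\<close> annihilated by \<open>x\<close> is the last nonzero \<open>x ^ j e y\<close>.\<close>

lemma (in cring) dichotomy_imp_local_idempotent:
  assumes e: "e \<in> carrier R" "e \<otimes> e = e" "e \<noteq> \<zero>"
    and dich: "\<And>x. x \<in> nonunits_at R e \<Longrightarrow> \<exists>k::nat. e \<otimes> x [^] k = \<zero>"
  shows "local_idempotent R e"
proof -
  let ?M = "nonunits_at R e"
  have M_carr: "x \<in> carrier R" if "x \<in> ?M" for x using that by (simp add: nonunits_at_def)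
  have M_mult: "a \<otimes> x \<in> ?M" if "x \<in> ?M" "a \<in> carrier R" for a x
  proof -
    have "r \<otimes> (a \<otimes> x) \<noteq> e" if "r \<in> carrier R" for r
    proof -
      have "(r \<otimes> a) \<otimes> x \<noteq> e"
        using \<open>x \<in> ?M\<close> \<open>a \<in> carrier R\<close> that unfolding nonunits_at_def by blast
      thus ?thesis using \<open>x \<in> ?M\<close> \<open>a \<in> carrier R\<close> that by (simp add: m_assoc M_carr)
    qed
    thus ?thesis using that by (auto simp: nonunits_at_def)
  qed
  have M_zero: "\<zero> \<in> ?M" using e by (auto simp: nonunits_at_def)
  have M_add: "x \<oplus> y \<in> ?M" if x: "x \<in> ?M" and y: "y \<in> ?M" for x y
  proof (rule ccontr)
    assume "x \<oplus> y \<notin> ?M"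
    then obtain r where r: "r \<in> carrier R" "r \<otimes> (x \<oplus> y) = e"
      using M_carr[OF x] M_carr[OF y] by (auto simp: nonunits_at_def)
    have xc: "x \<in> carrier R" and yc: "y \<in> carrier R" using x y M_carr by auto
    let ?u = "r \<otimes> x"
    obtain k :: nat where k: "e \<otimes> ?u [^] k = \<zero>" using dich[OF M_mult[OF x r(1)]] by blast
    obtain s where s: "s \<in> carrier R" "s \<otimes> (\<one> \<ominus> ?u) = \<one> \<ominus> ?u [^] k"
      using one_minus_dvd_one_minus_pow[of ?u k] xc r by auto
    have uk: "?u [^] k \<in> carrier R" using xc r by simp
    have "e \<otimes> (\<one> \<ominus> ?u) = e \<otimes> e \<ominus> e \<otimes> ?u" using e xc r by algebra
    also have "\<dots> = e \<otimes> (r \<otimes> (x \<oplus> y)) \<ominus> e \<otimes> ?u" using r by simp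
    also have "\<dots> = e \<otimes> r \<otimes> y" using e(1) xc yc r(1) by algebra
    finally have 1: "e \<otimes> (\<one> \<ominus> ?u) = e \<otimes> r \<otimes> y" .
    have "(s \<otimes> e \<otimes> r) \<otimes> y = s \<otimes> (e \<otimes> (\<one> \<ominus> ?u))" unfolding 1 using s e r yc by algebra
    also have "\<dots> = e \<otimes> (s \<otimes> (\<one> \<ominus> ?u))" using s(1) e(1) xc r(1) by algebra
    also have "\<dots> = e \<ominus> e \<otimes> ?u [^] k" unfolding s(2) using e(1) uk by algebra
    also have "\<dots> = e" unfolding k using e by (simp add: minus_eq)
    finally have "(s \<otimes> e \<otimes> r) \<otimes> y = e" .
    moreover have "s \<otimes> e \<otimes> r \<in> carrier R" using s e r by simp
    ultimately show False using y by (auto simp: nonunits_at_def)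
  qed
  have "ideal ?M R"
  proof (rule idealI)
    show "ring R" by (rule ring_axioms)
    show "subgroup ?M (add_monoid R)"
    proof (rule add.subgroupI)
      show "?M \<subseteq> carrier R" using M_carr by auto
      show "?M \<noteq> {}" using M_zero by auto
      show "\<ominus> a \<in> ?M" if "a \<in> ?M" for a
      proof -
        have "\<ominus> a = (\<ominus> \<one>) \<otimes> a" using M_carr[OF that] by (simp add: l_minus)
        thus ?thesis using M_mult[OF that, of "\<ominus> \<one>"] by simp
      qed
      show "a \<oplus> b \<in> ?M" if "a \<in> ?M" "b \<in> ?M" for a b using M_add that by auto
    qed
    show "x \<otimes> a \<in> ?M" if "a \<in> ?M" "x \<in> carrier R" for a x using M_mult that by auto
    show "a \<otimes> x \<in> ?M" if "a \<in> ?M" "x \<in> carrier R" for a x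
      using M_mult[OF that] m_comm[of a x] M_carr that by auto
  qed
  moreover have "\<exists>s\<in>carrier R. s \<otimes> (e \<otimes> y) \<noteq> \<zero> \<and> x \<otimes> (s \<otimes> (e \<otimes> y)) = \<zero>"
    if x: "x \<in> ?M" and y: "y \<in> carrier R" and ey: "e \<otimes> y \<noteq> \<zero>" for x y
  proof -
    have xc: "x \<in> carrier R" using x M_carr by auto
    obtain k0 :: nat where k0: "e \<otimes> x [^] k0 = \<zero>" using dich[OF x] by blast
    define k where "k = (LEAST k::nat. x [^] k \<otimes> (e \<otimes> y) = \<zero>)"
    have "x [^] k0 \<otimes> (e \<otimes> y) = (e \<otimes> x [^] k0) \<otimes> y"
      using nat_pow_closed[OF xc, of k0] e(1) y by (simp add: m_ac)
    hence "x [^] k0 \<otimes> (e \<otimes> y) = \<zero>" unfolding k0 using y by simp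
    hence k: "x [^] k \<otimes> (e \<otimes> y) = \<zero>" unfolding k_def by (rule LeastI)
    have "k \<noteq> 0"
    proof
      assume "k = 0"
      thus False using k ey e(1) y by simp
    qed
    then obtain j where j: "k = Suc j" by (cases k) auto
    have "x [^] j \<otimes> (e \<otimes> y) \<noteq> \<zero>"
      using not_less_Least[of j "\<lambda>k::nat. x [^] k \<otimes> (e \<otimes> y) = \<zero>"] j unfolding k_def by auto
    moreover have "x \<otimes> (x [^] j \<otimes> (e \<otimes> y)) = \<zero>"
      using k e y xc unfolding j by (simp add: m_ac)
    ultimately show ?thesis using xc by (intro bexI[of _ "x [^] j"]) auto
  qed
  ultimately show ?thesis using e unfolding local_idempotent_def by blast
qed

section \<open>Splitting an Artinian ring by idempotents\<close>

context artinian_cring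
begin

lemma wf_ideals: "wf {(I, J). ideal I R \<and> ideal J R \<and> I \<subset> J}"
  unfolding wf_iff_no_infinite_down_chain
proof
  assume "\<exists>I. \<forall>i. (I (Suc i), I i) \<in> {(I, J). ideal I R \<and> ideal J R \<and> I \<subset> J}"
  then obtain I where "\<forall>i :: nat. (I (Suc i), I i) \<in> {(I, J). ideal I R \<and> ideal J R \<and> I \<subset> J}" ..
  hence I: "\<And>i. ideal (I i) R \<and> I (Suc i) \<subset> I i" by simp
  have "\<exists>N. \<forall>n\<ge>N. I n = I N"
    by (rule descending_chain) (use I in blast)+
  then obtain N where N: "\<forall>n\<ge>N. I n = I N" ..
  have "I (Suc N) = I N" by (rule N[rule_format]) simp
  moreover have "I (Suc N) \<noteq> I N" using I[of N] by (elim conjE psubsetE) blast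
  ultimately show False by contradiction
qed

text \<open>The descending chain of the ideals generated by the powers of \<open>x\<close> stops at some exponent
  \<open>N\<close>; comparing the exponents \<open>N + 1\<close> and \<open>2 (N + 1)\<close> gives \<open>a = y a\<^sup>2\<close> for \<open>a = x ^ (N + 1)\<close>,
  so that \<open>y a\<close> is idempotent. The exponent is positive so that \<open>x\<close> divides \<open>a\<close>.\<close>

lemma strongly_pi_regular:
  assumes x: "x \<in> carrier R"
  shows "\<exists>k::nat. \<exists>y\<in>carrier R. x [^] Suc k = y \<otimes> (x [^] Suc k \<otimes> x [^] Suc k)"
proof -
  have "PIdl (x [^] Suc k) \<subseteq> PIdl (x [^] k)" for k :: nat
  proof (rule cgenideal_minimal[OF cgenideal_ideal])
    show "x [^] Suc k \<in> PIdl (x [^] k)"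
      unfolding cgenideal_def using x by (auto intro!: exI[of _ x] simp: m_comm)
  qed (use x in auto)
  hence "\<exists>N::nat. \<forall>n\<ge>N. PIdl (x [^] n) = PIdl (x [^] N)"
    using descending_chain[of "\<lambda>k. PIdl (x [^] k)"] cgenideal_ideal[OF nat_pow_closed[OF x]] by blast
  then obtain N :: nat where N: "\<forall>n\<ge>N. PIdl (x [^] n) = PIdl (x [^] N)" by blast
  have "x [^] Suc N \<in> PIdl (x [^] Suc N)" by (rule cgenideal_self) (use x in auto)
  also have "\<dots> = PIdl (x [^] (Suc N + Suc N))" using N by (metis le_add1 le_SucI le_refl trans_le_add1)
  finally obtain y where "y \<in> carrier R" "x [^] Suc N = y \<otimes> x [^] (Suc N + Suc N)"
    unfolding cgenideal_def by blast
  then show ?thesis unfolding nat_pow_mult[OF x, symmetric] by blast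
qed

text \<open>For \<open>a = x ^ (k + 1) = y a\<^sup>2\<close>, primitivity leaves two values for the idempotent \<open>e y a\<close>. If it is
  \<open>e\<close>, then \<open>x\<close> divides \<open>e\<close>; if it is \<open>\<zero>\<close>, then \<open>e a = e y a\<^sup>2 = \<zero>\<close>, so \<open>e x\<close> is nilpotent.\<close>

lemma primitive_imp_local_idempotent:
  assumes e: "e \<in> carrier R" "e \<otimes> e = e" "e \<noteq> \<zero>"
    and prim: "\<And>f. \<lbrakk>f \<in> carrier R; f \<otimes> f = f; e \<otimes> f = f\<rbrakk> \<Longrightarrow> f = \<zero> \<or> f = e"
  shows "local_idempotent R e"
proof (rule dichotomy_imp_local_idempotent[OF e])
  fix x assume xM: "x \<in> nonunits_at R e"
  hence x: "x \<in> carrier R" by (simp add: nonunits_at_def)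
  obtain k :: nat and y where y: "y \<in> carrier R" "x [^] Suc k = y \<otimes> (x [^] Suc k \<otimes> x [^] Suc k)"
    using strongly_pi_regular[OF x] by blast
  define a where "a = x [^] Suc k"
  have a: "a \<in> carrier R" "y \<otimes> (a \<otimes> a) = a" using x y unfolding a_def by (simp, metis)
  define f where "f = e \<otimes> (y \<otimes> a)"
  have f: "f \<in> carrier R" unfolding f_def using e y a by simp
  have "f \<otimes> f = (e \<otimes> e) \<otimes> (y \<otimes> (y \<otimes> (a \<otimes> a)))" unfolding f_def using e(1) y(1) a(1) by algebra
  hence ff: "f \<otimes> f = f" unfolding a e f_def .
  have "e \<otimes> f = (e \<otimes> e) \<otimes> (y \<otimes> a)" unfolding f_def using e(1) y(1) a(1) by algebra
  hence ef: "e \<otimes> f = f" unfolding a e f_def .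
  have "f \<noteq> e"
  proof
    assume "f = e"
    have "(e \<otimes> (y \<otimes> x [^] k)) \<otimes> x = f" unfolding f_def a_def using e(1) y(1) x by (simp add: m_assoc)
    thus False using xM \<open>f = e\<close> e y x by (auto simp: nonunits_at_def)
  qed
  hence "f = \<zero>" using prim[OF f ff ef] by simp
  have "e \<otimes> a = e \<otimes> (y \<otimes> (a \<otimes> a))" using a by simp
  also have "\<dots> = f \<otimes> a" unfolding f_def using e(1) y(1) a(1) by algebra
  also have "\<dots> = \<zero>" using \<open>f = \<zero>\<close> a by simp
  finally show "\<exists>k::nat. e \<otimes> x [^] k = \<zero>" unfolding a_def by blast
qed

text \<open>By well-founded induction on the ideal \<open>e R\<close>: unless \<open>e\<close> is zero or primitive, it splits as
  \<open>e = f + (e - f)\<close> into orthogonal idempotents that generate strictly smaller ideals. The clause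
  \<open>e g = g\<close> is what makes the two families obtained by induction orthogonal to each other.\<close>

lemma idempotent_decomposition:
  assumes "e \<in> carrier R" "e \<otimes> e = e"
  shows "\<exists>E. finite E \<and> (\<forall>g\<in>E. local_idempotent R g \<and> g \<noteq> \<zero> \<and> e \<otimes> g = g) \<and>
           (\<forall>g\<in>E. \<forall>h\<in>E. g \<noteq> h \<longrightarrow> g \<otimes> h = \<zero>) \<and> (\<Oplus>g\<in>E. g) = e"
  using wf_inv_image[OF wf_ideals, of "\<lambda>e. PIdl e"] assms
proof (induction e rule: wf_induct_rule)
  case (less e)
  note e = less.prems
  consider "e = \<zero>" | "e \<noteq> \<zero>" "\<And>f. \<lbrakk>f \<in> carrier R; f \<otimes> f = f; e \<otimes> f = f\<rbrakk> \<Longrightarrow> f = \<zero> \<or> f = e"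
    | f where "f \<in> carrier R" "f \<otimes> f = f" "e \<otimes> f = f" "f \<noteq> \<zero>" "f \<noteq> e" by blast
  then show ?case
  proof cases
    case 1
    then show ?thesis by (intro exI[of _ "{}"]) auto
  next
    case 2
    then have "local_idempotent R e" using primitive_imp_local_idempotent e by blast
    then show ?thesis using e 2(1) by (intro exI[of _ "{e}"]) auto
  next
    case f: 3
    have smaller: "(g, e) \<in> inv_image {(I, J). ideal I R \<and> ideal J R \<and> I \<subset> J} (\<lambda>e. PIdl e)"
      if g: "g \<in> carrier R" "g \<otimes> g = g" "e \<otimes> g = g" "g \<noteq> e" for g
    proof -
      have "g \<in> PIdl e" unfolding cgenideal_def using g e m_comm[of e g] by force
      hence sub: "PIdl g \<subseteq> PIdl e" by (intro cgenideal_minimal cgenideal_ideal e)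
      have "e \<notin> PIdl g"
      proof
        assume "e \<in> PIdl g"
        then obtain r where r: "r \<in> carrier R" "e = r \<otimes> g" by (auto simp: cgenideal_def)
        have "e \<otimes> g = r \<otimes> (g \<otimes> g)" using r g(1) by (simp add: m_assoc)
        thus False using r g by simp
      qed
      thus ?thesis using sub cgenideal_self[of e] cgenideal_ideal e g by auto
    qed
    define f' where "f' = e \<ominus> f"
    have f'c: "f' \<in> carrier R" unfolding f'_def using e f by simp
    have fe: "f \<otimes> e = f" using f e m_comm by metis
    have "f' \<otimes> f' = e \<otimes> e \<ominus> e \<otimes> f \<ominus> f \<otimes> e \<oplus> f \<otimes> f" unfolding f'_def using e(1) f(1) by algebra
    also have "\<dots> = f'" unfolding f'_def f e fe using e(1) f(1) by algebra
    finally have f'f': "f' \<otimes> f' = f'" .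
    have "e \<otimes> f' = e \<otimes> e \<ominus> e \<otimes> f" unfolding f'_def using e(1) f(1) by algebra
    hence ef': "e \<otimes> f' = f'" unfolding f'_def e f .
    have "f \<otimes> f' = f \<otimes> e \<ominus> f \<otimes> f" unfolding f'_def using e(1) f(1) by algebra
    hence ff': "f \<otimes> f' = \<zero>" unfolding fe f using f(1) by (simp add: minus_eq r_neg)
    have f_f': "f \<oplus> f' = e" unfolding f'_def using e(1) f(1) by algebra
    have "f' \<noteq> e" 
    proof
      assume "f' = e"
      hence "f \<otimes> e = \<zero>" using ff' by simp
      thus False using fe f by simp
    qed
    obtain E where E: "finite E" "\<forall>g\<in>E. local_idempotent R g \<and> g \<noteq> \<zero> \<and> f \<otimes> g = g"
        "\<forall>g\<in>E. \<forall>h\<in>E. g \<noteq> h \<longrightarrow> g \<otimes> h = \<zero>" "(\<Oplus>g\<in>E. g) = f"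
      using less.IH[OF smaller[of f]] f by auto
    obtain E' where E': "finite E'" "\<forall>g\<in>E'. local_idempotent R g \<and> g \<noteq> \<zero> \<and> f' \<otimes> g = g"
        "\<forall>g\<in>E'. \<forall>h\<in>E'. g \<noteq> h \<longrightarrow> g \<otimes> h = \<zero>" "(\<Oplus>g\<in>E'. g) = f'"
      using less.IH[OF smaller[OF f'c f'f' ef' \<open>f' \<noteq> e\<close>] f'c f'f'] by auto
    have Ec: "g \<in> carrier R" "g \<otimes> g = g" if "g \<in> E \<union> E'" for g
      using E(2) E'(2) that unfolding local_idempotent_def by auto
    have cross: "g \<otimes> h = \<zero>" if "g \<in> E" "h \<in> E'" for g h
    proof -
      have gh: "g \<in> carrier R" "h \<in> carrier R" using Ec that by auto
      have "g \<otimes> h = (f \<otimes> g) \<otimes> (f' \<otimes> h)" using E E' that by auto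
      also have "\<dots> = (f \<otimes> f') \<otimes> (g \<otimes> h)" using f(1) f'c gh by algebra
      finally show ?thesis using ff' gh by simp
    qed
    have cross': "h \<otimes> g = \<zero>" if "g \<in> E" "h \<in> E'" for g h
      using cross[OF that] m_comm[of g h] Ec that by auto
    have disj: "E \<inter> E' = {}"
    proof (rule ccontr)
      assume "E \<inter> E' \<noteq> {}"
      then obtain g where "g \<in> E" "g \<in> E'" by auto
      thus False using cross[of g g] Ec[of g] E(2) by auto
    qed
    have sum: "(\<Oplus>g\<in>E \<union> E'. g) = e"
      using finsum_Un_disjoint[OF E(1) E'(1) disj, of "\<lambda>g. g"] Ec E(4) E'(4) f_f' by auto
    have under: "e \<otimes> g = g"
      if "g \<in> carrier R" "d \<otimes> g = g" "d \<in> carrier R" "e \<otimes> d = d" for g d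
      using m_assoc[of e d g] e that by simp
    have "local_idempotent R g \<and> g \<noteq> \<zero> \<and> e \<otimes> g = g" if g: "g \<in> E \<union> E'" for g
    proof (cases "g \<in> E")
      case True
      then show ?thesis using E(2) under[OF Ec(1)[OF g] _ f(1) f(3)] by blast
    next
      case False
      then have "g \<in> E'" using g by blast
      then show ?thesis using E'(2) under[OF Ec(1)[OF g] _ f'c ef'] by blast
    qed
    moreover have "g \<otimes> h = \<zero>" if "g \<in> E \<union> E'" "h \<in> E \<union> E'" "g \<noteq> h" for g h
      using that E(3) E'(3) cross[of g h] cross'[of h g] by (elim UnE) simp_all
    ultimately show ?thesis using sum E(1) E'(1)
      by (intro exI[of _ "E \<union> E'"] conjI ballI impI finite_UnI) blast+
  qed
qed

end

text \<open>An internal description of the decompositions of \<open>R\<close> into \<open>n\<close> local factors; the \<open>i\<close>-th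
  factor is \<open>e\<^sub>i R\<close>. Indexing by natural numbers provides the order that is used to
  build a largest clique.\<close>

locale complete_local_idempotents = cring +
  fixes e :: "nat \<Rightarrow> 'a" and n :: nat
  assumes local: "i < n \<Longrightarrow> local_idempotent R (e i)"
    and orthogonal: "\<lbrakk>i < n; j < n; i \<noteq> j\<rbrakk> \<Longrightarrow> e i \<otimes> e j = \<zero>"
    and sum_one: "(\<Oplus>i\<in>{..<n}. e i) = \<one>"

lemma (in artinian_cring) ex_complete_local_idempotents: "\<exists>e n. complete_local_idempotents R e n"
proof -
  obtain E where E: "finite E" "\<forall>g\<in>E. local_idempotent R g"
      "\<forall>g\<in>E. \<forall>h\<in>E. g \<noteq> h \<longrightarrow> g \<otimes> h = \<zero>" "(\<Oplus>g\<in>E. g) = \<one>"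
    using idempotent_decomposition[of \<one>] by auto
  obtain es where es: "set es = E" "distinct es" using finite_distinct_list[OF E(1)] by blast
  have im: "(!) es ` {..<length es} = E" using es by (auto simp: set_conv_nth)
  have "(\<Oplus>g\<in>(!) es ` {..<length es}. g) = (\<Oplus>i\<in>{..<length es}. es ! i)"
    using E(2) es by (intro finsum_reindex) (auto simp: inj_on_nth local_idempotent_def)
  hence "(\<Oplus>i\<in>{..<length es}. es ! i) = \<one>" unfolding im E(4) by simp
  hence "complete_local_idempotents R ((!) es) (length es)"
    using E es by unfold_locales (auto simp: nth_eq_iff_index_eq)
  thus ?thesis by blast
qed

context complete_local_idempotents
begin

text \<open>For an ideal \<open>I\<close>, the condition \<open>e\<^sub>i \<in> I\<close> says that \<open>I\<close> contains the whole factor \<open>e\<^sub>i R\<close>.\<close>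

definition full :: "'a set \<Rightarrow> nat set" where
  "full I = {i. i < n \<and> e i \<in> I}"

definition supp :: "'a set \<Rightarrow> nat set" where
  "supp I = {i. i < n \<and> (\<exists>x\<in>I. e i \<otimes> x \<noteq> \<zero>)}"

text \<open>Factors that are fields: the maximal ideal of \<open>e\<^sub>i R\<close> is zero.\<close>

definition field_indices :: "nat set" where
  "field_indices = {i. i < n \<and> (\<forall>x\<in>nonunits_at R (e i). e i \<otimes> x = \<zero>)}"

lemma e_closed [simp]: "i < n \<Longrightarrow> e i \<in> carrier R"
  and e_idem [simp]: "i < n \<Longrightarrow> e i \<otimes> e i = e i"
  and ideal_nonunits: "i < n \<Longrightarrow> ideal (nonunits_at R (e i)) R"
  using local unfolding local_idempotent_def by auto

lemma kills_nonunit: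
  "\<lbrakk>i < n; x \<in> nonunits_at R (e i); y \<in> carrier R; e i \<otimes> y \<noteq> \<zero>\<rbrakk> \<Longrightarrow>
    \<exists>s\<in>carrier R. s \<otimes> (e i \<otimes> y) \<noteq> \<zero> \<and> x \<otimes> (s \<otimes> (e i \<otimes> y)) = \<zero>"
  using local unfolding local_idempotent_def by blast

lemma e_nonzero: assumes "i < n" shows "e i \<noteq> \<zero>"
proof
  assume "e i = \<zero>"
  moreover have "\<zero> \<in> nonunits_at R (e i)"
    using additive_subgroup.zero_closed[OF ideal.axioms(1)[OF ideal_nonunits[OF assms]]] .
  ultimately show False by (auto simp: nonunits_at_def)
qed

lemma e_notin_nonunits: "i < n \<Longrightarrow> e i \<notin> nonunits_at R (e i)"
  using e_idem[of i] e_closed[of i] unfolding nonunits_at_def by blast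

lemma annihilated_imp_nonunit:
  assumes i: "i < n" and x: "x \<in> carrier R" "e i \<otimes> x = \<zero>"
  shows "x \<in> nonunits_at R (e i)"
proof -
  have "r \<otimes> x \<noteq> e i" if r: "r \<in> carrier R" for r
  proof
    assume rx: "r \<otimes> x = e i"
    have "e i \<otimes> (r \<otimes> x) = r \<otimes> (e i \<otimes> x)" using i x(1) r by (simp add: m_lcomm)
    thus False using rx x r i e_nonzero by simp
  qed
  thus ?thesis using x by (simp add: nonunits_at_def)
qed

text \<open>Since \<open>x\<close> is the sum of its components \<open>e\<^sub>i x\<close>.\<close>

lemma ideal_mem_if_all_components:
  assumes I: "ideal I R" and x: "x \<in> carrier R" and mem: "\<And>i. i < n \<Longrightarrow> e i \<otimes> x \<in> I"
  shows "x \<in> I"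
proof -
  interpret I: ideal I R by fact
  have "(\<Oplus>i\<in>A. e i \<otimes> x) \<in> I" if "finite A" "A \<subseteq> {..<n}" for A
    using that
  proof (induction A rule: finite_induct)
    case (insert a A)
    then have "(\<Oplus>i\<in>insert a A. e i \<otimes> x) = e a \<otimes> x \<oplus> (\<Oplus>i\<in>A. e i \<otimes> x)"
      using x by (intro finsum_insert) auto
    then show ?case using insert mem by auto
  qed simp
  hence "(\<Oplus>i\<in>{..<n}. e i \<otimes> x) \<in> I" by blast
  moreover have "(\<Oplus>i\<in>{..<n}. e i \<otimes> x) = (\<Oplus>i\<in>{..<n}. e i) \<otimes> x"
    using x by (intro finsum_ldistr[symmetric]) auto
  ultimately show ?thesis using x by (simp add: sum_one)
qed

lemma ex_nonzero_component:
  assumes "x \<in> carrier R" "x \<noteq> \<zero>"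
  shows "\<exists>i<n. e i \<otimes> x \<noteq> \<zero>"
  using ideal_mem_if_all_components[OF zeroideal, of x] assms by auto

section \<open>Maximal ideals\<close>

lemma e_in_other_nonunits: "\<lbrakk>i < n; j < n; i \<noteq> j\<rbrakk> \<Longrightarrow> e j \<in> nonunits_at R (e i)"
  using orthogonal by (intro annihilated_imp_nonunit) auto

lemma e_mem_if_not_nonunit:
  assumes "ideal I R" "x \<in> I" "x \<notin> nonunits_at R (e i)"
  shows "e i \<in> I"
proof -
  interpret I: ideal I R by fact
  obtain r where r: "r \<in> carrier R" "r \<otimes> x = e i" using assms(2,3) I.Icarr by (auto simp: nonunits_at_def)
  show ?thesis using I.I_l_closed[OF assms(2) r(1)] r(2) by simp
qed

text \<open>An ideal strictly above this one contains \<open>e\<^sub>i\<close>, and it contains all other \<open>e\<^sub>j\<close> because these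
  have zero \<open>i\<close>-th component.\<close>

lemma maximal_nonunits:
  assumes i: "i < n"
  shows "maximalideal (nonunits_at R (e i)) R"
proof (rule maximalidealI)
  show "carrier R \<noteq> nonunits_at R (e i)" using e_notin_nonunits i e_closed by blast
  fix J assume J: "ideal J R" "nonunits_at R (e i) \<subseteq> J" "J \<subseteq> carrier R"
  interpret J: ideal J R by fact
  show "J = nonunits_at R (e i) \<or> J = carrier R"
  proof (cases "J = nonunits_at R (e i)")
    case False
    then obtain x where "x \<in> J" "x \<notin> nonunits_at R (e i)" using J by blast
    then have "e i \<in> J" using e_mem_if_not_nonunit J by blast
    hence eJ: "e j \<in> J" if "j < n" for j
      using that J(2) e_in_other_nonunits[OF i that] by (cases "j = i") auto
    have "carrier R \<subseteq> J"
      using ideal_mem_if_all_components[OF J(1)] J.I_r_closed[OF eJ] by blast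
    then show ?thesis using J(3) by blast
  qed simp
qed (rule ideal_nonunits[OF i])

text \<open>A proper ideal misses some \<open>e\<^sub>i\<close>, and then all its elements are non-units at \<open>e\<^sub>i\<close>.\<close>

lemma maximal_imp_nonunits:
  assumes "maximalideal M R"
  shows "\<exists>i<n. M = nonunits_at R (e i)"
proof -
  interpret M: maximalideal M R by fact
  have "\<exists>i<n. e i \<notin> M"
  proof (rule ccontr)
    assume "\<not> ?thesis"
    hence "e i \<in> M" if "i < n" for i using that by blast
    hence "carrier R \<subseteq> M"
      using ideal_mem_if_all_components[OF M.is_ideal] M.I_r_closed by blast
    thus False using M.I_notcarr M.a_subset by blast
  qed
  then obtain i where i: "i < n" "e i \<notin> M" by blast
  have "M \<subseteq> nonunits_at R (e i)"
    using e_mem_if_not_nonunit[OF M.is_ideal] i by blast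
  moreover have "nonunits_at R (e i) \<noteq> carrier R" using e_notin_nonunits i e_closed by blast
  moreover have "nonunits_at R (e i) \<subseteq> carrier R" using nonunits_at_carrier by (rule subsetI)
  ultimately have "M = nonunits_at R (e i)"
    using M.I_maximal[OF ideal_nonunits[OF i(1)]] by blast
  thus ?thesis using i(1) by blast
qed

lemma max_ideals_eq: "max_ideals R = (\<lambda>i. nonunits_at R (e i)) ` {..<n}"
  using maximal_nonunits maximal_imp_nonunits unfolding max_ideals_def by blast

lemma inj_on_nonunits: "inj_on (\<lambda>i. nonunits_at R (e i)) {..<n}"
  using e_in_other_nonunits e_notin_nonunits by (intro inj_onI) (metis lessThan_iff)

lemma card_max_ideals: "card (max_ideals R) = n"
  unfolding max_ideals_eq using card_image[OF inj_on_nonunits] by simp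

section \<open>Adjacency of ideals\<close>

lemma full_subset_supp: "full I \<subseteq> supp I"
  using e_nonzero unfolding full_def supp_def by (auto intro!: bexI)

lemma supp_subset: "supp I \<subseteq> {..<n}"
  unfolding supp_def by auto

lemma finite_supp: "finite (supp I)" and finite_full: "finite (full I)"
  using supp_subset full_subset_supp by (meson finite_lessThan finite_subset)+

lemma supp_empty_imp_zero:
  assumes "ideal I R" "supp I = {}" shows "I = {\<zero>}"
proof -
  interpret I: ideal I R by fact
  show ?thesis
    using ex_nonzero_component assms(2) I.Icarr I.zero_closed unfolding supp_def by blast
qed

lemma full_all_imp_carrier:
  assumes "ideal I R" "{..<n} \<subseteq> full I" shows "I = carrier R"
proof -
  interpret I: ideal I R by fact
  have "e i \<in> I" if "i < n" for i using assms that unfolding full_def by blast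
  hence "carrier R \<subseteq> I" using ideal_mem_if_all_components[OF assms(1)] I.I_r_closed by blast
  thus ?thesis using I.a_subset by blast
qed

lemma field_supp_imp_full:
  assumes "ideal I R" "i \<in> supp I" "i \<in> field_indices"
  shows "i \<in> full I"
  using assms e_mem_if_not_nonunit[OF assms(1)]
  unfolding supp_def field_indices_def full_def by blast

text \<open>A regular element \<open>x\<close> of \<open>I\<close> must be a unit in each factor where \<open>J\<close> is nonzero, since a non-unit
  annihilates a nonzero element of that component of \<open>J\<close>; then \<open>e\<^sub>i\<close> is a multiple of \<open>x\<close> and lies
  in \<open>I\<close>. Conversely the sum of the \<open>e\<^sub>i\<close> that lie in \<open>I\<close> is regular on \<open>J\<close>.\<close>

lemma regular_iff_supp_subset_full:
  assumes I: "ideal I R" and J: "ideal J R"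
  shows "(\<exists>x\<in>I. regular_element R J x) \<longleftrightarrow> supp J \<subseteq> full I"
proof
  interpret I: ideal I R by fact
  interpret J: ideal J R by fact
  {
    assume "\<exists>x\<in>I. regular_element R J x"
    then obtain x where x: "x \<in> I" "\<And>y. \<lbrakk>y \<in> J; y \<noteq> \<zero>\<rbrakk> \<Longrightarrow> x \<otimes> y \<noteq> \<zero>"
      unfolding regular_element_def by blast
    show "supp J \<subseteq> full I"
    proof
      fix i assume "i \<in> supp J"
      then obtain y where i: "i < n" and y: "y \<in> J" "e i \<otimes> y \<noteq> \<zero>" unfolding supp_def by blast
      have "x \<notin> nonunits_at R (e i)"
      proof
        assume "x \<in> nonunits_at R (e i)"
        then obtain s where s: "s \<in> carrier R" "s \<otimes> (e i \<otimes> y) \<noteq> \<zero>" "x \<otimes> (s \<otimes> (e i \<otimes> y)) = \<zero>"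
          using kills_nonunit[OF i _ J.Icarr[OF y(1)] y(2)] by blast
        have "s \<otimes> (e i \<otimes> y) \<in> J" using i y s by (intro J.I_l_closed) auto
        thus False using x(2) s by blast
      qed
      thus "i \<in> full I" using e_mem_if_not_nonunit[OF I x(1)] i unfolding full_def by blast
    qed
  next
    assume sub: "supp J \<subseteq> full I"
    define x where "x = (\<Oplus>i\<in>full I. e i)"
    have "(\<Oplus>i\<in>A. e i) \<in> I" if "finite A" "A \<subseteq> full I" for A
      using that
    proof (induction A rule: finite_induct)
      case (insert a A)
      then have "(\<Oplus>i\<in>insert a A. e i) = e a \<oplus> (\<Oplus>i\<in>A. e i)"
        by (intro finsum_insert) (auto simp: full_def)
      then show ?case using insert by (auto simp: full_def)
    qed simp
    hence xI: "x \<in> I" unfolding x_def using finite_full by blast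
    have ex: "e i \<otimes> x = e i" if i: "i \<in> full I" for i
    proof -
      have "e i \<otimes> x = (\<Oplus>j\<in>full I. e i \<otimes> e j)"
        unfolding x_def using i by (intro finsum_rdistr finite_full) (auto simp: full_def)
      also have "\<dots> = (\<Oplus>j\<in>full I. if i = j then e j else \<zero>)"
        using i orthogonal by (intro finsum_cong') (auto simp: full_def)
      also have "\<dots> = e i"
        using i by (intro finsum_singleton finite_full) (auto simp: full_def)
      finally show ?thesis .
    qed
    have "x \<otimes> y \<noteq> \<zero>" if y: "y \<in> J" "y \<noteq> \<zero>" for y
    proof
      assume xy: "x \<otimes> y = \<zero>"
      have yc: "y \<in> carrier R" using y J.Icarr by auto
      obtain i where i: "i < n" "e i \<otimes> y \<noteq> \<zero>" using ex_nonzero_component[OF yc y(2)] by blast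
      hence "i \<in> full I" using sub y unfolding supp_def by blast
      hence "e i \<otimes> y = e i \<otimes> (x \<otimes> y)" using ex i yc I.Icarr[OF xI] by (metis e_closed m_assoc)
      thus False using i xy by simp
    qed
    thus "\<exists>x\<in>I. regular_element R J x" using xI I.Icarr unfolding regular_element_def by blast
  }
qed

lemma adjacent_iff:
  assumes "I \<in> nontrivial_ideals R" "J \<in> nontrivial_ideals R" "I \<noteq> J"
  shows "{I, J} \<in> snd (regular_graph R) \<longleftrightarrow> supp J \<subseteq> full I \<or> supp I \<subseteq> full J"
proof -
  have id: "ideal I R" "ideal J R" using assms unfolding nontrivial_ideals_def by auto
  have "{I, J} \<in> snd (regular_graph R) \<longleftrightarrow>
      (\<exists>x\<in>I. regular_element R J x) \<or> (\<exists>x\<in>J. regular_element R I x)"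
    using assms unfolding regular_graph_def by (auto simp: doubleton_eq_iff)
  thus ?thesis using regular_iff_supp_subset_full id by simp
qed

section \<open>Upper bound on the size of a clique\<close>

text \<open>In each factor an ideal is zero, proper nonzero or everything, which the level counts as
  0, 1, 2; over a field factor the middle case does not occur and the count is 0 or 1.\<close>

definition level :: "'a set \<Rightarrow> nat" where
  "level I = card (full I) + card (supp I - field_indices)"

text \<open>Over a field factor a nonzero component already makes the factor full, so an ideal of level \<open>0\<close>
  has empty support. A proper ideal is not full in some factor and so stays below the maximal level.\<close>

lemma level_bounds:
  assumes "I \<in> nontrivial_ideals R"
  shows "level I \<in> {1..<2 * n - card field_indices}"
proof -
  have I: "ideal I R" "I \<noteq> {\<zero>}" "I \<noteq> carrier R" using assms unfolding nontrivial_ideals_def by auto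
  have "supp I \<noteq> {}" using supp_empty_imp_zero I by blast
  then obtain i where "i \<in> supp I" by blast
  hence "i \<in> full I \<or> i \<in> supp I - field_indices" using field_supp_imp_full[OF I(1)] by blast
  hence "card (full I) \<noteq> 0 \<or> card (supp I - field_indices) \<noteq> 0"
    using finite_full[of I] finite_supp[of I] by auto
  hence lower: "1 \<le> level I" unfolding level_def by linarith
  have "full I \<subset> {..<n}" using full_all_imp_carrier[OF I(1)] I(3) unfolding full_def by blast
  hence "card (full I) < n" using psubset_card_mono[of "{..<n}"] by simp
  moreover have fi: "field_indices \<subseteq> {..<n}" unfolding field_indices_def by auto
  have "card (supp I - field_indices) \<le> card ({..<n} - field_indices)"
    using supp_subset by (intro card_mono) auto
  moreover have "card ({..<n} - field_indices) = n - card field_indices"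
    using fi by (simp add: card_Diff_subset finite_subset)
  moreover have "card field_indices \<le> n" using card_mono[OF _ fi] by simp
  ultimately have "level I < 2 * n - card field_indices" unfolding level_def by linarith
  with lower show ?thesis by simp
qed

text \<open>If the levels agreed, then the full and the supporting factors of \<open>I\<close> and \<open>J\<close> would
  all coincide, and both ideals would be the sum of these factors.\<close>

lemma level_strict_mono:
  assumes I: "ideal I R" and J: "ideal J R" and sub: "supp J \<subseteq> full I" and "I \<noteq> J"
  shows "level J < level I"
proof -
  have sub': "full J \<subseteq> full I" "supp J - field_indices \<subseteq> supp I - field_indices"
    using sub full_subset_supp by blast+
  have "full J \<subset> full I \<or> supp J - field_indices \<subset> supp I - field_indices"
  proof (rule ccontr)
    assume "\<not> ?thesis"
    hence eq: "full J = full I" "supp J - field_indices = supp I - field_indices" using sub' by auto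
    have "supp I \<subseteq> full I"
      using field_supp_imp_full[OF I] eq(2) sub by blast
    have "K \<subseteq> L" if K: "ideal K R" and L: "ideal L R" and KL: "supp K \<subseteq> full L" for K L
    proof
      fix x assume x: "x \<in> K"
      interpret K: ideal K R by fact
      interpret L: ideal L R by fact
      show "x \<in> L"
      proof (rule ideal_mem_if_all_components[OF L K.Icarr[OF x]])
        fix i assume i: "i < n"
        show "e i \<otimes> x \<in> L"
        proof (cases "e i \<otimes> x = \<zero>")
          case False
          hence "e i \<in> L" using KL x i unfolding supp_def full_def by blast
          thus ?thesis using L.I_r_closed K.Icarr[OF x] by blast
        qed simp
      qed
    qed
    hence "I = J" using I J sub \<open>supp I \<subseteq> full I\<close> eq by blast
    thus False using \<open>I \<noteq> J\<close> by simp
  qed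
  moreover have "card (full J) \<le> card (full I)"
    "card (supp J - field_indices) \<le> card (supp I - field_indices)"
    using sub' finite_full finite_supp by (auto intro: card_mono)
  moreover have "full J \<subset> full I \<Longrightarrow> card (full J) < card (full I)"
    "supp J - field_indices \<subset> supp I - field_indices \<Longrightarrow>
       card (supp J - field_indices) < card (supp I - field_indices)"
    using finite_full finite_supp by (auto intro!: psubset_card_mono)
  ultimately show ?thesis unfolding level_def by linarith
qed

text \<open>Distinct members of a clique have distinct levels, none of them the level of \<open>0\<close> or of \<open>R\<close>.\<close>

lemma card_clique_le:
  assumes "is_clique (regular_graph R) C"
  shows "card C \<le> 2 * n - card field_indices - 1"
proof -
  have C: "C \<subseteq> nontrivial_ideals R"
    using assms unfolding is_clique_def regular_graph_def by simp
  have "inj_on level C"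
  proof (rule inj_onI, rule ccontr)
    fix I J assume IJ: "I \<in> C" "J \<in> C" "level I = level J" "I \<noteq> J"
    hence "{I, J} \<in> snd (regular_graph R)" using assms unfolding is_clique_def by blast
    hence "supp J \<subseteq> full I \<or> supp I \<subseteq> full J"
      using adjacent_iff[of I J] C IJ by blast
    moreover have "ideal I R" "ideal J R" using C IJ unfolding nontrivial_ideals_def by auto
    ultimately show False using level_strict_mono[of I J] level_strict_mono[of J I] IJ by fastforce
  qed
  moreover have "level ` C \<subseteq> {1..<2 * n - card field_indices}" using level_bounds C by blast
  ultimately have "card C \<le> card {1..<2 * n - card field_indices}"
    by (intro card_inj_on_le) auto
  thus ?thesis by simp
qed

section \<open>A clique of maximal size\<close>

text \<open>The product of the full factors over \<open>A\<close>, the maximal ideals of the factors over \<open>B - A\<close>, and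
  zero elsewhere.\<close>

definition box :: "nat set \<Rightarrow> nat set \<Rightarrow> 'a set" where
  "box A B = {x \<in> carrier R. \<forall>i<n. (i \<notin> A \<longrightarrow> x \<in> nonunits_at R (e i)) \<and> (i \<notin> B \<longrightarrow> e i \<otimes> x = \<zero>)}"

lemma ideal_box: "ideal (box A B) R"
proof -
  have zero: "\<zero> \<in> nonunits_at R (e i)" if "i < n" for i
    using additive_subgroup.zero_closed[OF ideal.axioms(1)[OF ideal_nonunits[OF that]]] .
  have mult: "x \<otimes> a \<in> box A B" if a: "a \<in> box A B" and x: "x \<in> carrier R" for a x
  proof -
    have ac: "a \<in> carrier R" using a unfolding box_def by simp
    have "e i \<otimes> (x \<otimes> a) = x \<otimes> (e i \<otimes> a)" if "i < n" for i using that x ac by (simp add: m_lcomm)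
    thus ?thesis using a x ac ideal.I_l_closed[OF ideal_nonunits] unfolding box_def by auto
  qed
  show ?thesis
  proof (rule idealI)
    show "ring R" by (rule ring_axioms)
    show "subgroup (box A B) (add_monoid R)"
    proof (rule add.subgroupI)
      show "box A B \<subseteq> carrier R" unfolding box_def by blast
      have "\<zero> \<in> box A B" using zero unfolding box_def by auto
      thus "box A B \<noteq> {}" by blast
      show "\<ominus> a \<in> box A B" if "a \<in> box A B" for a
      proof -
        have "\<ominus> a = (\<ominus> \<one>) \<otimes> a" using that by (simp add: l_minus box_def)
        thus ?thesis using mult[OF that, of "\<ominus> \<one>"] by simp
      qed
      show "a \<oplus> b \<in> box A B" if "a \<in> box A B" "b \<in> box A B" for a b
        using that additive_subgroup.a_closed[OF ideal.axioms(1)[OF ideal_nonunits]]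
        unfolding box_def by (auto simp: r_distr)
    qed
    show "x \<otimes> a \<in> box A B" if "a \<in> box A B" "x \<in> carrier R" for a x using mult that by auto
    show "a \<otimes> x \<in> box A B" if "a \<in> box A B" "x \<in> carrier R" for a x
      using mult[OF that] m_comm[of a x] that unfolding box_def by auto
  qed
qed

lemma full_box:
  assumes "A \<subseteq> B" "B \<subseteq> {..<n}"
  shows "full (box A B) = A"
proof
  show "full (box A B) \<subseteq> A" using e_notin_nonunits unfolding full_def box_def by blast
  show "A \<subseteq> full (box A B)"
  proof
    fix i assume i: "i \<in> A"
    hence "i < n" using assms by blast
    moreover have "e i \<in> nonunits_at R (e j)" if "j < n" "j \<notin> A" for j
      using e_in_other_nonunits[of j i] that i \<open>i < n\<close> by blast
    moreover have "e j \<otimes> e i = \<zero>" if "j < n" "j \<notin> B" for j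
      using orthogonal[of j i] that i \<open>i < n\<close> assms by blast
    ultimately show "i \<in> full (box A B)" unfolding full_def box_def by auto
  qed
qed

text \<open>Over a factor in \<open>B - A\<close> the component is the maximal ideal, which is nonzero exactly when the
  factor is not a field.\<close>

lemma supp_box:
  assumes "A \<subseteq> B" "B \<subseteq> {..<n}" "(B - A) \<inter> field_indices = {}"
  shows "supp (box A B) = B"
proof
  show "supp (box A B) \<subseteq> B" unfolding supp_def box_def by blast
  show "B \<subseteq> supp (box A B)"
  proof
    fix i assume i: "i \<in> B"
    hence "i < n" using assms by blast
    show "i \<in> supp (box A B)"
    proof (cases "i \<in> A")
      case True
      then show ?thesis using full_box[OF assms(1,2)] full_subset_supp by blast
    next
      case False
      then obtain x where x: "x \<in> nonunits_at R (e i)" "e i \<otimes> x \<noteq> \<zero>"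
        using assms(3) i \<open>i < n\<close> unfolding field_indices_def by blast
      have xc: "x \<in> carrier R" using nonunits_at_carrier[OF x(1)] .
      have zero: "e j \<otimes> (e i \<otimes> x) = \<zero>" if "j < n" "j \<noteq> i" for j
        using orthogonal[of j i] that \<open>i < n\<close> xc by (simp add: m_assoc[symmetric])
      have "e i \<otimes> x \<in> nonunits_at R (e j)" if "j < n" for j
      proof (cases "j = i")
        case True
        then show ?thesis using ideal.I_l_closed[OF ideal_nonunits[OF \<open>i < n\<close>] x(1)] \<open>i < n\<close> by simp
      next
        case False
        then show ?thesis using zero[OF that] annihilated_imp_nonunit[OF that] xc \<open>i < n\<close> by simp
      qed
      hence "e i \<otimes> x \<in> box A B" using zero xc i \<open>i < n\<close> unfolding box_def by auto
      moreover have "e i \<otimes> (e i \<otimes> x) \<noteq> \<zero>"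
        using x xc \<open>i < n\<close> by (simp add: m_assoc[symmetric])
      ultimately show ?thesis using \<open>i < n\<close> unfolding supp_def by blast
    qed
  qed
qed

text \<open>For \<open>S\<^sub>0, S\<^sub>1, \<dots>\<close> the factors of \<open>R\<close>, with maximal ideals \<open>m\<^sub>k\<close>, the clique consists of
  the ideals \<open>S\<^sub>0 \<times> \<dots> \<times> S\<^sub>k\<^sub>-\<^sub>1\<close> with \<open>0 < k < n\<close> and of the ideals \<open>S\<^sub>0 \<times> \<dots> \<times> S\<^sub>k\<^sub>-\<^sub>1 \<times> m\<^sub>k\<close>
  with \<open>S\<^sub>k\<close> not a field. A pair \<open>(a, b)\<close> stands for the ideal whose full factors are those below
  \<open>a\<close> and whose support consists of those below \<open>b\<close>. The members of the clique realise every level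
  strictly between those of \<open>0\<close> and \<open>R\<close>.\<close>

lemma ex_clique:
  "\<exists>C. finite C \<and> is_clique (regular_graph R) C \<and> card C = 2 * n - card field_indices - 1"
proof -
  define T where "T = (\<lambda>k. (k, k)) ` {1..<n} \<union> (\<lambda>k. (k, Suc k)) ` ({..<n} - field_indices)"
  define L where "L = (\<lambda>(a, b). box {..<a} {..<b})"
  have T: "a \<le> b \<and> b \<le> n \<and> ({..<b} - {..<a}) \<inter> field_indices = {}" if "(a, b) \<in> T" for a b
    using that unfolding T_def by (auto simp: less_Suc_eq)
  have full: "full (L (a, b)) = {..<a}" if "(a, b) \<in> T" for a b
    unfolding L_def using T[OF that] by (simp add: full_box)
  have supp: "supp (L (a, b)) = {..<b}" if "(a, b) \<in> T" for a b
    unfolding L_def using T[OF that] by (simp add: supp_box)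
  have inj: "inj_on L T"
  proof (rule inj_onI, clarify)
    fix a b c d assume *: "(a, b) \<in> T" "(c, d) \<in> T" "L (a, b) = L (c, d)"
    hence "{..<a} = {..<c}" "{..<b} = {..<d}" using full supp by metis+
    thus "a = c \<and> b = d" by simp
  qed
  have nontriv: "L (a, b) \<in> nontrivial_ideals R" if ab: "(a, b) \<in> T" for a b
  proof -
    have "0 < b" "a < n" using ab unfolding T_def by auto
    moreover have "supp {\<zero>} = {}" unfolding supp_def by auto
    moreover have "full (carrier R) = {..<n}" unfolding full_def by auto
    ultimately have "L (a, b) \<noteq> {\<zero>}" "L (a, b) \<noteq> carrier R"
      using supp[OF ab] full[OF ab] by (metis lessThan_iff empty_iff, metis lessThan_iff less_irrefl)
    then show ?thesis unfolding nontrivial_ideals_def L_def using ideal_box by simp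
  qed
  have order: "b \<le> c \<or> d \<le> a" if "(a, b) \<in> T" "(c, d) \<in> T" "(a, b) \<noteq> (c, d)" for a b c d
    using that unfolding T_def by auto
  have "is_clique (regular_graph R) (L ` T)"
    unfolding is_clique_def
  proof (intro conjI ballI impI)
    show "L ` T \<subseteq> fst (regular_graph R)" using nontriv unfolding regular_graph_def by auto
    fix u v assume uv: "u \<in> L ` T" "v \<in> L ` T" "u \<noteq> v"
    then obtain a b c d where *: "(a, b) \<in> T" "(c, d) \<in> T" "u = L (a, b)" "v = L (c, d)" by auto
    have "b \<le> c \<or> d \<le> a" using order[OF *(1,2)] uv * by auto
    hence "supp v \<subseteq> full u \<or> supp u \<subseteq> full v" using * full supp by auto
    thus "{u, v} \<in> snd (regular_graph R)" using adjacent_iff[of u v] nontriv * uv(3) by auto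
  qed
  moreover have "card T = (n - 1) + (n - card field_indices)"
  proof -
    have fi: "field_indices \<subseteq> {..<n}" unfolding field_indices_def by auto
    have "card T = card ((\<lambda>k. (k, k)) ` {1..<n}) + card ((\<lambda>k. (k, Suc k)) ` ({..<n} - field_indices))"
      unfolding T_def by (rule card_Un_disjoint) auto
    also have "\<dots> = card {1..<n} + card ({..<n} - field_indices)"
      by (simp add: card_image inj_on_def)
    also have "card ({..<n} - field_indices) = n - card field_indices"
      using fi by (simp add: card_Diff_subset finite_subset)
    finally show ?thesis by simp
  qed
  moreover have "finite T" unfolding T_def by simp
  moreover have "card field_indices \<le> n"
    using card_mono[of "{..<n}" field_indices] unfolding field_indices_def by auto
  moreover have "card field_indices = 0" if "n = 0"
    using that unfolding field_indices_def by simp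
  ultimately show ?thesis
    using card_image[OF inj] by (intro exI[of _ "L ` T"]) auto
qed

theorem clique_number_eq: "clique_number (regular_graph R) = enat (2 * n - card field_indices - 1)"
proof (rule antisym)
  show "clique_number (regular_graph R) \<le> enat (2 * n - card field_indices - 1)"
    unfolding clique_number_def using card_clique_le by (auto intro!: Sup_least)
  obtain C where C: "finite C" "is_clique (regular_graph R) C" "card C = 2 * n - card field_indices - 1"
    using ex_clique by blast
  have "enat (card C) \<le> clique_number (regular_graph R)"
    unfolding clique_number_def using C by (intro Sup_upper) blast
  thus "enat (2 * n - card field_indices - 1) \<le> clique_number (regular_graph R)" using C by simp
qed

end

section \<open>Factors as images of the ring\<close>

text \<open>A surjective homomorphism whose kernel is the annihilator of the idempotent \<open>e\<close>: it identifies
  \<open>e R\<close> with \<open>S\<close>. Both the projection onto a factor of a decomposition and the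
  multiplication by \<open>e\<close> are of this kind, so that local rings and local idempotents can be compared
  in one place.\<close>

locale corner_map = ring_hom_cring R S h for R (structure) and S (structure) and h +
  fixes e
  assumes surj: "h ` carrier R = carrier S"
    and e_carr [simp]: "e \<in> carrier R"
    and e_idem [simp]: "e \<otimes> e = e"
    and ker_iff: "x \<in> carrier R \<Longrightarrow> h x = \<zero>\<^bsub>S\<^esub> \<longleftrightarrow> e \<otimes> x = \<zero>"
begin

lemma ex_preimage: "s \<in> carrier S \<Longrightarrow> \<exists>x\<in>carrier R. s = h x"
  unfolding surj[symmetric] by blast

lemma h_eq_iff:
  assumes "x \<in> carrier R" "y \<in> carrier R"
  shows "h x = h y \<longleftrightarrow> e \<otimes> x = e \<otimes> y"
proof -
  have "h x = h y \<longleftrightarrow> h (x \<ominus> y) = \<zero>\<^bsub>S\<^esub>"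
    using assms by (simp add: a_minus_def S.r_neg)
      (metis S.minus_equality S.r_neg S.minus_minus hom_closed S.a_inv_closed S.add.m_comm)
  also have "\<dots> \<longleftrightarrow> e \<otimes> (x \<ominus> y) = \<zero>" using assms by (intro ker_iff) simp
  also have "e \<otimes> (x \<ominus> y) = e \<otimes> x \<ominus> e \<otimes> y" using assms e_carr by algebra
  also have "e \<otimes> x \<ominus> e \<otimes> y = \<zero> \<longleftrightarrow> e \<otimes> x = e \<otimes> y" using assms by simp
  finally show ?thesis .
qed

lemma h_e: "h e = \<one>\<^bsub>S\<^esub>"
  using h_eq_iff[of e \<one>] by simp

lemma nonunits_iff:
  assumes "x \<in> carrier R"
  shows "h x \<in> nonunits_at S \<one>\<^bsub>S\<^esub> \<longleftrightarrow> x \<in> nonunits_at R e"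
proof -
  have "(\<exists>s\<in>carrier S. s \<otimes>\<^bsub>S\<^esub> h x = \<one>\<^bsub>S\<^esub>) \<longleftrightarrow> (\<exists>r\<in>carrier R. r \<otimes> x = e)"
  proof
    assume "\<exists>s\<in>carrier S. s \<otimes>\<^bsub>S\<^esub> h x = \<one>\<^bsub>S\<^esub>"
    then obtain r where r: "r \<in> carrier R" "h r \<otimes>\<^bsub>S\<^esub> h x = \<one>\<^bsub>S\<^esub>"
      using ex_preimage by blast
    hence "h (r \<otimes> x) = h e" using assms by (simp add: h_e)
    hence "e \<otimes> (r \<otimes> x) = e" using h_eq_iff[of "r \<otimes> x" e] r assms by simp
    hence "(e \<otimes> r) \<otimes> x = e" using r assms by (simp add: R.m_assoc)
    thus "\<exists>r\<in>carrier R. r \<otimes> x = e" using r by (intro bexI[of _ "e \<otimes> r"]) auto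
  next
    assume "\<exists>r\<in>carrier R. r \<otimes> x = e"
    then obtain r where "r \<in> carrier R" "r \<otimes> x = e" by blast
    hence "h r \<otimes>\<^bsub>S\<^esub> h x = \<one>\<^bsub>S\<^esub>" using assms h_e hom_mult by metis
    thus "\<exists>s\<in>carrier S. s \<otimes>\<^bsub>S\<^esub> h x = \<one>\<^bsub>S\<^esub>" using \<open>r \<in> carrier R\<close> by blast
  qed
  thus ?thesis using assms by (auto simp: nonunits_at_def)
qed

lemma ideal_preimage:
  assumes "ideal J S" shows "ideal {x \<in> carrier R. h x \<in> J} R"
proof -
  interpret J: ideal J S by fact
  show ?thesis
  proof (intro idealI R.ring_axioms R.add.subgroupI)
    show "{x \<in> carrier R. h x \<in> J} \<noteq> {}" using J.zero_closed hom_zero by force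
  qed (auto simp: J.I_l_closed J.I_r_closed)
qed

lemma image_preimage:
  assumes "J \<subseteq> carrier S" shows "h ` {x \<in> carrier R. h x \<in> J} = J"
  using assms ex_preimage by blast

lemma ideal_image:
  assumes "ideal I R" shows "ideal (h ` I) S"
proof -
  interpret I: ideal I R by fact
  show ?thesis
  proof (intro idealI S.ring_axioms S.add.subgroupI)
    show "h ` I \<subseteq> carrier S" using I.Icarr by auto
    show "h ` I \<noteq> {}" using I.zero_closed by blast
    show "\<ominus>\<^bsub>S\<^esub> a \<in> h ` I" if "a \<in> h ` I" for a
    proof -
      obtain x where x: "x \<in> I" "a = h x" using \<open>a \<in> h ` I\<close> by blast
      hence "\<ominus>\<^bsub>S\<^esub> a = h (\<ominus> x)" using I.Icarr by simp
      thus ?thesis using I.a_inv_closed[OF x(1)] by (rule image_eqI)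
    qed
    show "a \<oplus>\<^bsub>S\<^esub> b \<in> h ` I" if ab: "a \<in> h ` I" "b \<in> h ` I" for a b
    proof -
      obtain x where x: "x \<in> I" "a = h x" using ab(1) by blast
      obtain y where y: "y \<in> I" "b = h y" using ab(2) by blast
      have "a \<oplus>\<^bsub>S\<^esub> b = h (x \<oplus> y)" using x y I.Icarr by simp
      thus ?thesis using I.a_closed[OF x(1) y(1)] by (rule image_eqI)
    qed
    fix a s assume as: "a \<in> h ` I" "s \<in> carrier S"
    obtain x where x: "x \<in> I" "a = h x" using as(1) by blast
    obtain r where r: "r \<in> carrier R" "s = h r" using ex_preimage[OF as(2)] by blast
    have "s \<otimes>\<^bsub>S\<^esub> a = h (r \<otimes> x)" using x r I.Icarr by simp
    thus "s \<otimes>\<^bsub>S\<^esub> a \<in> h ` I" using I.I_l_closed[OF x(1) r(1)] by (rule image_eqI)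
    have "a \<otimes>\<^bsub>S\<^esub> s = h (x \<otimes> r)" using x r I.Icarr by simp
    thus "a \<otimes>\<^bsub>S\<^esub> s \<in> h ` I" using I.I_r_closed[OF x(1) r(1)] by (rule image_eqI)
  qed
qed

lemma ideal_nonunits_iff: "ideal (nonunits_at S \<one>\<^bsub>S\<^esub>) S \<longleftrightarrow> ideal (nonunits_at R e) R"
proof -
  have pre: "{x \<in> carrier R. h x \<in> nonunits_at S \<one>\<^bsub>S\<^esub>} = nonunits_at R e"
    using nonunits_iff by (auto simp: nonunits_at_def)
  have "nonunits_at S \<one>\<^bsub>S\<^esub> \<subseteq> carrier S" by (auto simp: nonunits_at_def)
  from image_preimage[OF this] have "h ` nonunits_at R e = nonunits_at S \<one>\<^bsub>S\<^esub>" unfolding pre .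
  thus ?thesis using ideal_preimage[of "nonunits_at S \<one>\<^bsub>S\<^esub>"] ideal_image[of "nonunits_at R e"] pre by metis
qed

text \<open>All clauses in the definition of a local idempotent speak of products up to elements annihilated
  by \<open>e\<close>, and these are what \<open>h\<close> sends to zero.\<close>

lemma local_idempotent_iff: "local_idempotent S \<one>\<^bsub>S\<^esub> \<longleftrightarrow> local_idempotent R e"
proof -
  have nonzero_iff: "\<one>\<^bsub>S\<^esub> \<otimes>\<^bsub>S\<^esub> h y \<noteq> \<zero>\<^bsub>S\<^esub> \<longleftrightarrow> e \<otimes> y \<noteq> \<zero>" if "y \<in> carrier R" for y
    using ker_iff that by simp
  have s_iff: "s \<otimes> (e \<otimes> y) = \<zero> \<longleftrightarrow> h s \<otimes>\<^bsub>S\<^esub> (\<one>\<^bsub>S\<^esub> \<otimes>\<^bsub>S\<^esub> h y) = \<zero>\<^bsub>S\<^esub>"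
    if "s \<in> carrier R" "y \<in> carrier R" for s y
    using ker_iff[of "s \<otimes> y"] that by (simp add: R.m_lcomm[of _ e])
  have xs_iff: "x \<otimes> (s \<otimes> (e \<otimes> y)) = \<zero> \<longleftrightarrow> h x \<otimes>\<^bsub>S\<^esub> (h s \<otimes>\<^bsub>S\<^esub> (\<one>\<^bsub>S\<^esub> \<otimes>\<^bsub>S\<^esub> h y)) = \<zero>\<^bsub>S\<^esub>"
    if "x \<in> carrier R" "s \<in> carrier R" "y \<in> carrier R" for x s y
    using ker_iff[of "x \<otimes> (s \<otimes> y)"] that by (simp add: R.m_lcomm[of _ e])
  have all_iff: "(\<forall>y\<in>carrier S. P y) \<longleftrightarrow> (\<forall>y\<in>carrier R. P (h y))"
    and ex_iff: "(\<exists>y\<in>carrier S. P y) \<longleftrightarrow> (\<exists>y\<in>carrier R. P (h y))" for P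
    using ex_preimage hom_closed by metis+
  have M_iff: "(\<forall>x\<in>nonunits_at S \<one>\<^bsub>S\<^esub>. P x) \<longleftrightarrow> (\<forall>x\<in>nonunits_at R e. P (h x))" for P
  proof
    assume *: "\<forall>x\<in>nonunits_at S \<one>\<^bsub>S\<^esub>. P x"
    show "\<forall>x\<in>nonunits_at R e. P (h x)"
    proof
      fix x assume x: "x \<in> nonunits_at R e"
      hence "x \<in> carrier R" by (simp add: nonunits_at_def)
      thus "P (h x)" using * x nonunits_iff by blast
    qed
  next
    assume *: "\<forall>x\<in>nonunits_at R e. P (h x)"
    show "\<forall>x\<in>nonunits_at S \<one>\<^bsub>S\<^esub>. P x"
    proof
      fix y assume y: "y \<in> nonunits_at S \<one>\<^bsub>S\<^esub>"
      hence "y \<in> carrier S" by (simp add: nonunits_at_def)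
      then obtain x where "x \<in> carrier R" "y = h x" using ex_preimage by blast
      thus "P y" using * y nonunits_iff by blast
    qed
  qed
  have "(\<forall>x\<in>nonunits_at R e. \<forall>y\<in>carrier R. e \<otimes> y \<noteq> \<zero> \<longrightarrow>
        (\<exists>s\<in>carrier R. s \<otimes> (e \<otimes> y) \<noteq> \<zero> \<and> x \<otimes> (s \<otimes> (e \<otimes> y)) = \<zero>)) \<longleftrightarrow>
      (\<forall>x\<in>nonunits_at R e. \<forall>y\<in>carrier R. \<one>\<^bsub>S\<^esub> \<otimes>\<^bsub>S\<^esub> h y \<noteq> \<zero>\<^bsub>S\<^esub> \<longrightarrow>
        (\<exists>s\<in>carrier R. h s \<otimes>\<^bsub>S\<^esub> (\<one>\<^bsub>S\<^esub> \<otimes>\<^bsub>S\<^esub> h y) \<noteq> \<zero>\<^bsub>S\<^esub> \<and>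
           h x \<otimes>\<^bsub>S\<^esub> (h s \<otimes>\<^bsub>S\<^esub> (\<one>\<^bsub>S\<^esub> \<otimes>\<^bsub>S\<^esub> h y)) = \<zero>\<^bsub>S\<^esub>))"
    by (intro ball_cong refl imp_cong bex_cong conj_cong nonzero_iff)
      (simp_all only: nonunits_at_def mem_Collect_eq nonzero_iff s_iff xs_iff not_False_eq_True)
  thus ?thesis
    unfolding local_idempotent_def M_iff all_iff ex_iff ideal_nonunits_iff by simp
qed

lemma nonunits_zero_iff:
  "(\<forall>x\<in>nonunits_at S \<one>\<^bsub>S\<^esub>. x = \<zero>\<^bsub>S\<^esub>) \<longleftrightarrow> (\<forall>x\<in>nonunits_at R e. e \<otimes> x = \<zero>)"
proof
  assume *: "\<forall>x\<in>nonunits_at S \<one>\<^bsub>S\<^esub>. x = \<zero>\<^bsub>S\<^esub>"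
  show "\<forall>x\<in>nonunits_at R e. e \<otimes> x = \<zero>"
  proof
    fix x assume x: "x \<in> nonunits_at R e"
    hence "x \<in> carrier R" by (simp add: nonunits_at_def)
    thus "e \<otimes> x = \<zero>" using * x nonunits_iff ker_iff by blast
  qed
next
  assume *: "\<forall>x\<in>nonunits_at R e. e \<otimes> x = \<zero>"
  show "\<forall>x\<in>nonunits_at S \<one>\<^bsub>S\<^esub>. x = \<zero>\<^bsub>S\<^esub>"
  proof
    fix y assume y: "y \<in> nonunits_at S \<one>\<^bsub>S\<^esub>"
    hence "y \<in> carrier S" by (simp add: nonunits_at_def)
    then obtain x where "x \<in> carrier R" "y = h x" using ex_preimage by blast
    thus "y = \<zero>\<^bsub>S\<^esub>" using * y nonunits_iff ker_iff by blast
  qed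
qed

text \<open>Ideals of \<open>S\<close> are recovered from their preimages, so a chain stops when the chain of preimages
  does.\<close>

lemma artinian_image:
  assumes "artinian_cring R" shows "artinian_cring S"
proof -
  interpret A: artinian_cring R by fact
  show ?thesis
  proof unfold_locales
    fix I :: "nat \<Rightarrow> 'c set" assume I: "\<And>n. ideal (I n) S" "\<And>n. I (Suc n) \<subseteq> I n"
    define K where "K n = {x \<in> carrier R. h x \<in> I n}" for n
    have "\<exists>N. \<forall>n\<ge>N. K n = K N"
    proof (rule A.descending_chain)
      show "ideal (K n) R" for n unfolding K_def by (rule ideal_preimage[OF I(1)])
      show "K (Suc n) \<subseteq> K n" for n unfolding K_def using I(2) by blast
    qed
    then obtain N where N: "\<forall>n\<ge>N. K n = K N" ..
    have "I n = h ` K n" for n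
    proof -
      have "I n \<subseteq> carrier S" using ideal.Icarr[OF I(1)] by blast
      thus ?thesis unfolding K_def by (rule image_preimage[symmetric])
    qed
    hence "\<forall>n\<ge>N. I n = I N" using N by metis
    thus "\<exists>N. \<forall>n\<ge>N. I n = I N" ..
  qed
qed

end

text \<open>The number of local factors of \<open>S\<close> is its number of maximal ideals. So there is just one, and
  its idempotent is \<open>\<one>\<close>, the sum of the system.\<close>

lemma artinian_local_imp_local_idempotent:
  fixes S (structure)
  assumes "artinian_local_ring S" shows "local_idempotent S \<one>"
proof -
  interpret artinian_cring S using assms unfolding artinian_local_ring_def by blast
  obtain e n where en: "complete_local_idempotents S e n" using ex_complete_local_idempotents by blast
  interpret complete_local_idempotents S e n by fact
  obtain M where "max_ideals S = {M}"
    using assms unfolding artinian_local_ring_def max_ideals_def by blast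
  hence n: "n = 1" using card_max_ideals by simp
  have "(\<Oplus>i\<in>{..<n}. e i) = e 0" using e_closed n by (simp add: lessThan_Suc)
  thus ?thesis using local[of 0] sum_one n by simp
qed

text \<open>Here \<open>\<one>\<close> alone is a complete system, so that there is exactly one maximal ideal.\<close>

lemma local_idempotent_imp_artinian_local:
  fixes S (structure)
  assumes "artinian_cring S" "local_idempotent S \<one>" shows "artinian_local_ring S"
proof -
  interpret artinian_cring S by fact
  interpret complete_local_idempotents S "\<lambda>_. \<one>" 1
    using assms(2) by unfold_locales (auto simp: lessThan_Suc)
  obtain M where "max_ideals S = {M}" using card_max_ideals card_1_singletonE by metis
  hence "maximalideal K S \<longleftrightarrow> K = M" for K unfolding max_ideals_def by blast
  thus ?thesis using assms(1) unfolding artinian_local_ring_def by blast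
qed

lemma field_iff_nonunits_zero:
  fixes S (structure)
  assumes "cring S" "local_idempotent S \<one>"
  shows "field S \<longleftrightarrow> (\<forall>x\<in>nonunits_at S \<one>. x = \<zero>)"
proof
  interpret cring S by fact
  {
    assume "field S"
    then interpret field S .
    show "\<forall>x\<in>nonunits_at S \<one>. x = \<zero>"
      using field_Units Units_l_inv_ex unfolding nonunits_at_def by blast
  next
    assume *: "\<forall>x\<in>nonunits_at S \<one>. x = \<zero>"
    show "field S"
    proof (rule cring_fieldI2)
      have "\<zero> \<in> nonunits_at S \<one>"
        using additive_subgroup.zero_closed[OF ideal.axioms(1)] assms(2)
        unfolding local_idempotent_def by blast
      thus "\<zero> \<noteq> \<one>" by (auto simp: nonunits_at_def)
      fix a assume "a \<in> carrier S" "a \<noteq> \<zero>"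
      thus "\<exists>b\<in>carrier S. a \<otimes> b = \<one>" using * m_comm by (auto simp: nonunits_at_def)
    qed
  }
qed

section \<open>Decompositions into local rings and complete systems of local idempotents\<close>

lemma RDirProd_list_Cons_ops:
  assumes "a \<in> carrier R" "b \<in> carrier R" "as \<in> carrier (RDirProd_list Rs)" "bs \<in> carrier (RDirProd_list Rs)"
  shows "(a # as) \<otimes>\<^bsub>RDirProd_list (R # Rs)\<^esub> (b # bs) = (a \<otimes>\<^bsub>R\<^esub> b) # (as \<otimes>\<^bsub>RDirProd_list Rs\<^esub> bs)"
    and "(a # as) \<oplus>\<^bsub>RDirProd_list (R # Rs)\<^esub> (b # bs) = (a \<oplus>\<^bsub>R\<^esub> b) # (as \<oplus>\<^bsub>RDirProd_list Rs\<^esub> bs)"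
  using ring_hom_mult[OF RDirProd_list_hom1, of "(a, as)" R Rs "(b, bs)"]
    ring_hom_add[OF RDirProd_list_hom1, of "(a, as)" R Rs "(b, bs)"] assms
  by (simp_all add: RDirProd_def DirProd_def monoid.defs)

lemma RDirProd_list_ops_nth:
  assumes "i < length Rs" "as \<in> carrier (RDirProd_list Rs)" "bs \<in> carrier (RDirProd_list Rs)"
  shows "(as \<otimes>\<^bsub>RDirProd_list Rs\<^esub> bs) ! i = as ! i \<otimes>\<^bsub>Rs ! i\<^esub> bs ! i \<and>
    (as \<oplus>\<^bsub>RDirProd_list Rs\<^esub> bs) ! i = as ! i \<oplus>\<^bsub>Rs ! i\<^esub> bs ! i"
  using assms
proof (induction Rs arbitrary: i as bs)
  case (Cons R Rs)
  obtain a as' b bs' where *: "as = a # as'" "bs = b # bs'" "a \<in> carrier R" "b \<in> carrier R"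
      "as' \<in> carrier (RDirProd_list Rs)" "bs' \<in> carrier (RDirProd_list Rs)"
    using Cons.prems(2,3) unfolding RDirProd_list_carrier by auto
  show ?case
    unfolding *(1,2) RDirProd_list_Cons_ops[OF *(3-6)] using Cons * by (cases i) auto
qed simp

lemma RDirProd_list_one_nth: "i < length Rs \<Longrightarrow> \<one>\<^bsub>RDirProd_list Rs\<^esub> ! i = \<one>\<^bsub>Rs ! i\<^esub>"
  unfolding RDirProd_list_one by (induction Rs arbitrary: i) (auto simp: nth_Cons split: nat.split)

lemma nth_ring_hom:
  assumes "i < length Rs"
  shows "(\<lambda>as. as ! i) \<in> ring_hom (RDirProd_list Rs) (Rs ! i)"
  using assms RDirProd_list_ops_nth[OF assms] RDirProd_list_one_nth[OF assms] RDirProd_list_carrier_mem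
  by (intro ring_hom_memI) auto

text \<open>The preimages of the unit vectors of the product are the idempotents. The order of the factors is
  kept, so that the field factors are counted by \<open>field_indices\<close>.\<close>

lemma complete_local_idempotents_of_decomposition:
  fixes R (structure) and Rs :: "('b, 'n) ring_scheme list"
  assumes R: "cring R" and dec: "local_decomposition R Rs"
  shows "\<exists>e. complete_local_idempotents R e (length Rs) \<and>
    card (complete_local_idempotents.field_indices R e (length Rs)) = length (filter field Rs)"
proof -
  interpret cring R by fact
  define n where "n = length Rs"
  have loc: "artinian_local_ring (Rs ! i)" if "i < n" for i
    using dec that unfolding local_decomposition_def n_def by auto
  have cr: "cring (Rs ! i)" if "i < n" for i
    using loc[OF that] unfolding artinian_local_ring_def artinian_cring_def by blast
  obtain h where h: "h \<in> ring_iso R (RDirProd_list Rs)"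
    using dec unfolding local_decomposition_def is_ring_iso_def by blast
  have hom: "(\<lambda>x. h x ! i) \<in> ring_hom R (Rs ! i)" if "i < n" for i
    using ring_hom_trans[OF _ nth_ring_hom, of h R Rs i] h that unfolding ring_iso_def n_def comp_def by blast
  have bij: "bij_betw h (carrier R) (carrier (RDirProd_list Rs))" using ring_iso_memE(5)[OF h] .
  have hring: "ring_hom_cring R (Rs ! i) (\<lambda>x. h x ! i)" if "i < n" for i
    using R cr[OF that] hom[OF that]
    by (simp add: ring_hom_cring_def ring_hom_cring_axioms_def)
  \<comment> \<open>Elements of \<open>R\<close> are determined by their coordinates \<open>h x ! i\<close>, and all coordinates occur.\<close>
  have ext: "x = y" if "x \<in> carrier R" "y \<in> carrier R" "\<And>i. i < n \<Longrightarrow> h x ! i = h y ! i" for x y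
  proof -
    have "h x \<in> carrier (RDirProd_list Rs)" "h y \<in> carrier (RDirProd_list Rs)"
      using bij that(1,2) by (auto simp: bij_betw_def)
    hence "length (h x) = n" "length (h y) = n" unfolding n_def by (auto dest: RDirProd_list_carrier_mem)
    hence "h x = h y" using that(3) by (intro nth_equalityI) auto
    thus ?thesis using bij that(1,2) by (auto simp: bij_betw_def inj_on_def)
  qed
  have ex: "\<exists>x\<in>carrier R. \<forall>i<n. h x ! i = f i" if "\<And>i. i < n \<Longrightarrow> f i \<in> carrier (Rs ! i)" for f
  proof -
    have "map f [0..<n] \<in> carrier (RDirProd_list Rs)"
      using that unfolding n_def by (intro RDirProd_list_carrier_memI) auto
    also have "\<dots> = h ` carrier R" using bij by (simp add: bij_betw_def)
    finally obtain x where "x \<in> carrier R" "h x = map f [0..<n]" by (metis imageE)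
    thus ?thesis by (intro bexI[of _ x]) auto
  qed
  have "\<exists>x\<in>carrier R. \<forall>j<n. h x ! j = (if i = j then \<one>\<^bsub>Rs ! j\<^esub> else \<zero>\<^bsub>Rs ! j\<^esub>)" for i
  proof (rule ex)
    fix j assume "j < n"
    then interpret S: cring "Rs ! j" by (rule cr)
    show "(if i = j then \<one>\<^bsub>Rs ! j\<^esub> else \<zero>\<^bsub>Rs ! j\<^esub>) \<in> carrier (Rs ! j)" by simp
  qed
  then obtain e where e: "\<And>i. e i \<in> carrier R"
    "\<And>i j. j < n \<Longrightarrow> h (e i) ! j = (if i = j then \<one>\<^bsub>Rs ! j\<^esub> else \<zero>\<^bsub>Rs ! j\<^esub>)" by metis
  have mult: "h (x \<otimes> y) ! j = h x ! j \<otimes>\<^bsub>Rs ! j\<^esub> h y ! j"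
    if "j < n" "x \<in> carrier R" "y \<in> carrier R" for x y j
    using ring_hom_mult[OF hom[OF that(1)]] that by simp
  have closed: "h x ! j \<in> carrier (Rs ! j)" if "j < n" "x \<in> carrier R" for x j
    using ring_hom_closed[OF hom[OF that(1)]] that by simp
  have zero: "h \<zero> ! j = \<zero>\<^bsub>Rs ! j\<^esub>" if "j < n" for j
  proof -
    interpret H: ring_hom_cring R "Rs ! j" "\<lambda>x. h x ! j" by (rule hring[OF that])
    show ?thesis by (rule H.hom_zero)
  qed
  have e_mult: "h (e i \<otimes> x) ! j = (if i = j then h x ! j else \<zero>\<^bsub>Rs ! j\<^esub>)"
    if "j < n" "x \<in> carrier R" for i j x
  proof -
    interpret S: cring "Rs ! j" by (rule cr[OF that(1)])
    show ?thesis using mult[OF that(1) e(1) that(2)] e(2)[OF that(1)] closed[OF that] by simp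
  qed
  have corner: "corner_map R (Rs ! i) (\<lambda>x. h x ! i) (e i)" if i: "i < n" for i
  proof -
    interpret H: ring_hom_cring R "Rs ! i" "\<lambda>x. h x ! i" by (rule hring[OF i])
    show ?thesis
    proof unfold_locales
      show "(\<lambda>x. h x ! i) ` carrier R = carrier (Rs ! i)"
      proof
        show "carrier (Rs ! i) \<subseteq> (\<lambda>x. h x ! i) ` carrier R"
        proof
          fix y assume y: "y \<in> carrier (Rs ! i)"
          have "\<exists>x\<in>carrier R. \<forall>j<n. h x ! j = (if j = i then y else \<zero>\<^bsub>Rs ! j\<^esub>)"
          proof (rule ex)
            fix j assume "j < n"
            then interpret S: cring "Rs ! j" by (rule cr)
            show "(if j = i then y else \<zero>\<^bsub>Rs ! j\<^esub>) \<in> carrier (Rs ! j)" using y by simp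
          qed
          then obtain x where "x \<in> carrier R" "h x ! i = y" using i by auto
          thus "y \<in> (\<lambda>x. h x ! i) ` carrier R" by blast
        qed
      qed (use closed i in blast)
      show "e i \<in> carrier R" by (rule e)
      show "e i \<otimes> e i = e i" using e by (intro ext) (auto simp: e_mult)
      fix x assume x: "x \<in> carrier R"
      show "h x ! i = \<zero>\<^bsub>Rs ! i\<^esub> \<longleftrightarrow> e i \<otimes> x = \<zero>"
      proof
        assume "h x ! i = \<zero>\<^bsub>Rs ! i\<^esub>"
        thus "e i \<otimes> x = \<zero>" using e x zero by (intro ext) (auto simp: e_mult)
      next
        assume "e i \<otimes> x = \<zero>"
        thus "h x ! i = \<zero>\<^bsub>Rs ! i\<^esub>" using e_mult[OF i x, of i] zero[OF i] by simp
      qed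
    qed
  qed
  have LI: "complete_local_idempotents R e n"
  proof unfold_locales
    show "local_idempotent R (e i)" if "i < n" for i
      using corner_map.local_idempotent_iff[OF corner[OF that]]
        artinian_local_imp_local_idempotent[OF loc[OF that]] by blast
    show "e i \<otimes> e j = \<zero>" if "i < n" "j < n" "i \<noteq> j" for i j
      using e zero that by (intro ext) (auto simp: e_mult)
    show "(\<Oplus>i\<in>{..<n}. e i) = \<one>"
    proof (rule ext)
      fix j assume j: "j < n"
      interpret H: ring_hom_cring R "Rs ! j" "\<lambda>x. h x ! j" by (rule hring[OF j])
      have "h (\<Oplus>i\<in>{..<n}. e i) ! j = (\<Oplus>\<^bsub>Rs ! j\<^esub>i\<in>{..<n}. h (e i) ! j)"
        using e(1) by (subst H.hom_finsum) (auto simp: comp_def)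
      also have "\<dots> = (\<Oplus>\<^bsub>Rs ! j\<^esub>i\<in>{..<n}. if j = i then \<one>\<^bsub>Rs ! j\<^esub> else \<zero>\<^bsub>Rs ! j\<^esub>)"
        using e(2)[OF j] by (intro H.S.finsum_cong') auto
      also have "\<dots> = \<one>\<^bsub>Rs ! j\<^esub>"
        using j by (intro H.S.finsum_singleton) auto
      finally show "h (\<Oplus>i\<in>{..<n}. e i) ! j = h \<one> ! j" by simp
    qed (use e in auto)
  qed
  interpret L: complete_local_idempotents R e n by (rule LI)
  have "L.field_indices = {i. i < length Rs \<and> field (Rs ! i)}"
    unfolding L.field_indices_def n_def[symmetric]
    using corner_map.nonunits_zero_iff[OF corner] field_iff_nonunits_zero[OF cr]
      artinian_local_imp_local_idempotent[OF loc] by auto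
  hence "card L.field_indices = length (filter field Rs)" by (simp add: length_filter_conv_card)
  thus ?thesis using LI unfolding n_def by blast
qed

text \<open>The ring \<open>e R\<close> with identity \<open>e\<close>, for an idempotent \<open>e\<close>: the fixed points of multiplication by
  \<open>e\<close> are then its multiples.\<close>

definition corner :: "('a, 'm) ring_scheme \<Rightarrow> 'a \<Rightarrow> 'a ring" where
  "corner R e = \<lparr>carrier = {x \<in> carrier R. e \<otimes>\<^bsub>R\<^esub> x = x}, monoid.mult = monoid.mult R, one = e,
     ring.zero = \<zero>\<^bsub>R\<^esub>, ring.add = ring.add R\<rparr>"

lemma corner_sel [simp]:
  "carrier (corner R e) = {x \<in> carrier R. e \<otimes>\<^bsub>R\<^esub> x = x}" "monoid.mult (corner R e) = monoid.mult R"
  "one (corner R e) = e" "ring.zero (corner R e) = \<zero>\<^bsub>R\<^esub>" "ring.add (corner R e) = ring.add R"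
  by (simp_all add: corner_def)

lemma (in cring) corner_map_corner:
  assumes e: "e \<in> carrier R" "e \<otimes> e = e"
  shows "corner_map R (corner R e) (\<lambda>x. e \<otimes> x) e"
proof -
  have neg: "e \<otimes> (\<ominus> x) = \<ominus> x" if "x \<in> carrier R" "e \<otimes> x = x" for x
    using e that by (simp add: r_minus)
  interpret S: cring "corner R e"
  proof (intro cringI abelian_groupI comm_monoidI)
    show "\<exists>y\<in>carrier (corner R e). y \<oplus>\<^bsub>corner R e\<^esub> x = \<zero>\<^bsub>corner R e\<^esub>"
      if "x \<in> carrier (corner R e)" for x
      using that neg by (intro bexI[of _ "\<ominus> x"]) (auto simp: l_neg)
    show "x \<otimes>\<^bsub>corner R e\<^esub> y \<in> carrier (corner R e)"
      if "x \<in> carrier (corner R e)" "y \<in> carrier (corner R e)" for x y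
      using that e m_assoc[of e x y] by simp
    show "x \<otimes>\<^bsub>corner R e\<^esub> y \<otimes>\<^bsub>corner R e\<^esub> z = x \<otimes>\<^bsub>corner R e\<^esub> (y \<otimes>\<^bsub>corner R e\<^esub> z)"
      if "x \<in> carrier (corner R e)" "y \<in> carrier (corner R e)" "z \<in> carrier (corner R e)" for x y z
      using that by (simp add: m_assoc)
    show "x \<otimes>\<^bsub>corner R e\<^esub> y = y \<otimes>\<^bsub>corner R e\<^esub> x"
      if "x \<in> carrier (corner R e)" "y \<in> carrier (corner R e)" for x y
      using that by (simp add: m_comm)
  qed (use e in \<open>simp_all add: r_distr l_distr a_ac\<close>)
  have ee: "e \<otimes> (e \<otimes> x) = e \<otimes> x" if "x \<in> carrier R" for x
    using e that by (simp add: m_assoc[symmetric])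
  show ?thesis
  proof unfold_locales
    show "(\<lambda>x. e \<otimes> x) \<in> ring_hom R (corner R e)"
    proof (rule ring_hom_memI)
      fix x y assume xy: "x \<in> carrier R" "y \<in> carrier R"
      have "(e \<otimes> x) \<otimes> (e \<otimes> y) = (e \<otimes> e) \<otimes> (x \<otimes> y)" using e(1) xy by algebra
      thus "e \<otimes> (x \<otimes> y) = (e \<otimes> x) \<otimes>\<^bsub>corner R e\<^esub> (e \<otimes> y)" using e by simp
    qed (use e ee in \<open>auto simp: r_distr\<close>)
    show "(\<lambda>x. e \<otimes> x) ` carrier R = carrier (corner R e)" using e ee by force
  qed (use e in auto)
qed

text \<open>The isomorphism is \<open>x \<mapsto> (e\<^sub>i x)\<^sub>i\<close>; its inverse adds up the coordinates.\<close>

lemma (in complete_local_idempotents) decomposition_corners: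
  assumes "artinian_cring R"
  shows "local_decomposition R (map (\<lambda>i. corner R (e i)) [0..<n])"
proof -
  let ?Rs = "map (\<lambda>i. corner R (e i)) [0..<n]"
  let ?h = "\<lambda>x. map (\<lambda>i. e i \<otimes> x) [0..<n]"
  have loc: "artinian_local_ring (corner R (e i))" if "i < n" for i
  proof -
    interpret corner_map R "corner R (e i)" "\<lambda>x. e i \<otimes> x" "e i"
      using that by (intro corner_map_corner) auto
    show ?thesis
      using local_idempotent_imp_artinian_local[OF artinian_image[OF assms]] local_idempotent_iff local[OF that]
      by blast
  qed
  have ee: "e i \<otimes> (e i \<otimes> x) = e i \<otimes> x" if "i < n" "x \<in> carrier R" for i x
    using that by (simp add: m_assoc[symmetric])
  have closed: "?h x \<in> carrier (RDirProd_list ?Rs)" if "x \<in> carrier R" for x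
    using that ee by (intro RDirProd_list_carrier_memI) auto
  interpret P: ring "RDirProd_list ?Rs"
    using loc by (intro RDirProd_list_is_ring)
      (auto simp: artinian_local_ring_def artinian_cring_def cring_def)
  have len: "length (as \<otimes>\<^bsub>RDirProd_list ?Rs\<^esub> bs) = n" "length (as \<oplus>\<^bsub>RDirProd_list ?Rs\<^esub> bs) = n"
    if "as \<in> carrier (RDirProd_list ?Rs)" "bs \<in> carrier (RDirProd_list ?Rs)" for as bs
    using RDirProd_list_carrier_mem(1)[OF P.m_closed[OF that]]
      RDirProd_list_carrier_mem(1)[OF P.a_closed[OF that]] by simp_all
  have "?h \<in> ring_iso R (RDirProd_list ?Rs)"
  proof (rule ring_iso_memI)
    fix x y assume xy: "x \<in> carrier R" "y \<in> carrier R"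
    show "?h x \<in> carrier (RDirProd_list ?Rs)" by (rule closed[OF xy(1)])
    have "e i \<otimes> (x \<otimes> y) = (e i \<otimes> x) \<otimes> (e i \<otimes> y)" if i: "i < n" for i
    proof -
      have "(e i \<otimes> x) \<otimes> (e i \<otimes> y) = (e i \<otimes> e i) \<otimes> (x \<otimes> y)" using e_closed[OF i] xy by algebra
      thus ?thesis using i by simp
    qed
    thus "?h (x \<otimes> y) = ?h x \<otimes>\<^bsub>RDirProd_list ?Rs\<^esub> ?h y"
      using RDirProd_list_ops_nth[OF _ closed[OF xy(1)] closed[OF xy(2)]] len[OF closed[OF xy(1)] closed[OF xy(2)]]
      by (intro nth_equalityI) auto
    show "?h (x \<oplus> y) = ?h x \<oplus>\<^bsub>RDirProd_list ?Rs\<^esub> ?h y"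
      using RDirProd_list_ops_nth[OF _ closed[OF xy(1)] closed[OF xy(2)]] len[OF closed[OF xy(1)] closed[OF xy(2)]] xy
      by (intro nth_equalityI) (auto simp: r_distr)
  next
    have "length \<one>\<^bsub>RDirProd_list ?Rs\<^esub> = n"
      using RDirProd_list_carrier_mem(1)[OF P.one_closed] by simp
    thus "?h \<one> = \<one>\<^bsub>RDirProd_list ?Rs\<^esub>"
      by (intro nth_equalityI) (auto simp: RDirProd_list_one_nth)
  next
    have inj: "inj_on ?h (carrier R)"
    proof (rule inj_onI)
      fix x y assume xy: "x \<in> carrier R" "y \<in> carrier R" "?h x = ?h y"
      have eq: "e i \<otimes> x = e i \<otimes> y" if "i < n" for i
        using arg_cong[OF xy(3), of "\<lambda>l. l ! i"] that by simp
      have "x \<ominus> y \<in> {\<zero>}"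
      proof (rule ideal_mem_if_all_components[OF zeroideal])
        fix i assume i: "i < n"
        have "e i \<otimes> (x \<ominus> y) = e i \<otimes> x \<ominus> e i \<otimes> y" using e_closed[OF i] xy(1,2) by algebra
        thus "e i \<otimes> (x \<ominus> y) \<in> {\<zero>}" using eq[OF i] e_closed[OF i] xy by simp
      qed (use xy in simp)
      thus "x = y" using xy by simp
    qed
    have "as \<in> ?h ` carrier R" if as: "as \<in> carrier (RDirProd_list ?Rs)" for as
    proof -
      have l: "length as = n" using RDirProd_list_carrier_mem(1)[OF as] by simp
      have asi: "as ! i \<in> carrier R" "e i \<otimes> as ! i = as ! i" if "i < n" for i
        using RDirProd_list_carrier_mem(2)[OF as, of i] that by auto
      define x where "x = (\<Oplus>i\<in>{..<n}. as ! i)"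
      have "e j \<otimes> x = as ! j" if j: "j < n" for j
      proof -
        have "e j \<otimes> as ! i = \<zero>" if "i < n" "i \<noteq> j" for i
        proof -
          have "e j \<otimes> as ! i = e j \<otimes> (e i \<otimes> as ! i)" using asi that by simp
          also have "\<dots> = (e j \<otimes> e i) \<otimes> as ! i"
            using asi(1)[OF that(1)] that j by (simp add: m_assoc)
          also have "\<dots> = \<zero>" using orthogonal[OF j that(1)] asi(1)[OF that(1)] that by simp
          finally show ?thesis .
        qed
        hence coord: "e j \<otimes> as ! i = (if j = i then as ! i else \<zero>)" if "i < n" for i using asi(2) that by auto
        have "e j \<otimes> x = (\<Oplus>i\<in>{..<n}. e j \<otimes> as ! i)"
          unfolding x_def using j asi by (intro finsum_rdistr) auto
        also have "\<dots> = (\<Oplus>i\<in>{..<n}. if j = i then as ! i else \<zero>)"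
          using coord asi by (intro finsum_cong') auto
        also have "\<dots> = as ! j" using j asi by (intro finsum_singleton) auto
        finally show ?thesis .
      qed
      hence "as = ?h x" using l by (intro nth_equalityI) auto
      moreover have "x \<in> carrier R" unfolding x_def using asi by (intro finsum_closed) auto
      ultimately show ?thesis by blast
    qed
    thus "bij_betw ?h (carrier R) (carrier (RDirProd_list ?Rs))"
      unfolding bij_betw_def using inj closed by blast
  qed
  thus ?thesis unfolding local_decomposition_def is_ring_iso_def using loc by auto
qed

text \<open>Every decomposition has as many factors as there are maximal ideals, and its number of field
  factors is then determined by the clique number, a quantity that depends on \<open>R\<close> only. Hence
  the number of field factors is well defined, and the formula holds as soon as one
  decomposition exists.\<close>

theorem proposition5:
  fixes R :: "('a, 'm) ring_scheme"
  assumes "artinian_cring R" and "\<one>\<^bsub>R\<^esub> \<noteq> \<zero>\<^bsub>R\<^esub>"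
  shows "\<exists>w :: nat. clique_number (regular_graph R) = enat w \<and>
           int w = 2 * int (card (max_ideals R)) - int (num_field_factors R) - 1"
proof -
  interpret R: artinian_cring R by fact
  have eqs: "clique_number (regular_graph R) = enat (2 * length Rs - length (filter field Rs) - 1)"
    "card (max_ideals R) = length Rs" "0 < length Rs" if dec: "local_decomposition R Rs" for Rs :: "'a ring list"
  proof -
    obtain e where e: "complete_local_idempotents R e (length Rs)"
      "card (complete_local_idempotents.field_indices R e (length Rs)) = length (filter field Rs)"
      using complete_local_idempotents_of_decomposition[OF R.is_cring dec] by blast
    interpret complete_local_idempotents R e "length Rs" by (rule e(1))
    show "clique_number (regular_graph R) = enat (2 * length Rs - length (filter field Rs) - 1)"
      using clique_number_eq e(2) by simp
    show "card (max_ideals R) = length Rs" by (rule card_max_ideals)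
    show "0 < length Rs" using sum_one assms(2) by (cases Rs) auto
  qed
  obtain e n where "complete_local_idempotents R e n" using R.ex_complete_local_idempotents by blast
  then obtain Rs :: "'a ring list" where Rs: "local_decomposition R Rs"
    using complete_local_idempotents.decomposition_corners[OF _ assms(1)] by blast
  have le: "length (filter field Qs) \<le> length Qs" for Qs :: "'a ring list" by (rule length_filter_le)
  \<comment> \<open>The subtraction in the formula is exact because there is at least one factor and at most all
    of them are fields, so equal clique numbers give equal numbers of field factors.\<close>
  have "num_field_factors R = length (filter field Rs)"
    unfolding num_field_factors_def
  proof (rule the_equality)
    fix k assume "\<exists>Qs :: 'a ring list. local_decomposition R Qs \<and> k = length (filter field Qs)"
    then obtain Qs :: "'a ring list" where Qs: "local_decomposition R Qs" "k = length (filter field Qs)" by blast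
    have "length Qs = length Rs" using eqs(2)[OF Qs(1)] eqs(2)[OF Rs] by simp
    moreover have "2 * length Qs - length (filter field Qs) - 1 = 2 * length Rs - length (filter field Rs) - 1"
      using eqs(1)[OF Qs(1)] eqs(1)[OF Rs] by simp
    ultimately show "k = length (filter field Rs)"
      using le[of Qs] le[of Rs] eqs(3)[OF Rs] Qs(2) by linarith
  qed (use Rs in blast)
  moreover have "int (2 * length Rs - length (filter field Rs) - 1) =
      2 * int (length Rs) - int (length (filter field Rs)) - 1"
    using eqs(3)[OF Rs] le[of Rs] by linarith
  ultimately show ?thesis using eqs(1,2)[OF Rs] by simp
qed

end
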